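(* Let $P\subset\mathbb R^2$ be a $\mathbb Z$-$\Delta_2$-free polygon whose interior contains at least two points of $\mathbb Z^2$. Then $\mathrm{width}(P)\le\frac{10}{3}$. Moreover, equality holds if and only if $P$ is $\mathbb Z$-unimodularly equivalent to the triangle $\mathrm{conv}\big(\tfrac13e_1+\tfrac53e_2,\;-\tfrac43e_1-\tfrac53e_2,\;2e_1\big)$, which contains exactly two interior lattice points.
   Context: A polygon is a two-dimensional convex polytope in $\mathbb R^2$. $\Delta_2=\mathrm{conv}(\mathbf 0,e_1,e_2)$. A $\mathbb Z$-unimodular transformation is $T(x)=Mx+b$ with $M\in\mathrm{GL}_2(\mathbb Z)$, $b\in\mathbb Z^2$; a $\mathbb Z$-unimodular copy of $X$ is $T(X)$, and two sets are $\mathbb Z$-unimodularly equivalent if one is the image of the other under such a $T$. A convex set is $\mathbb Z$-$\Delta_2$-free if its relative interior contains no $\mathbb Z$-unimodular copy of $\Delta_2$. Lattice width: $\mathrm{width}(K)=\inf_{u\in(\mathbb Z^2)^*\setminus\{0\}}\sup_{x,y\in K}|u(x)-u(y)|$. *)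

theory Defs
  imports "HOL-Analysis.Analysis"
begin

definition lattice_points :: "(real \<times> real) set" where
  "lattice_points = {(of_int a, of_int b) | a b :: int. True}"

definition is_polygon :: "(real \<times> real) set \<Rightarrow> bool" where
  "is_polygon P \<longleftrightarrow> (\<exists>S. finite S \<and> P = convex hull S) \<and> interior P \<noteq> {}"

definition aff_map :: "int \<Rightarrow> int \<Rightarrow> int \<Rightarrow> int \<Rightarrow> int \<Rightarrow> int \<Rightarrow> real \<times> real \<Rightarrow> real \<times> real" where
  "aff_map a b c d e f = (\<lambda>(x, y). (of_int a * x + of_int b * y + of_int e,
                                     of_int c * x + of_int d * y + of_int f))"

definition unimodular_map :: "(real \<times> real \<Rightarrow> real \<times> real) \<Rightarrow> bool" where
  "unimodular_map T \<longleftrightarrow> (\<exists>a b c d e f :: int. (a * d - b * c = 1 \<or> a * d - b * c = -1)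
                                      \<and> T = aff_map a b c d e f)"

definition std_simplex :: "(real \<times> real) set" where
  "std_simplex = convex hull {(0, 0), (1, 0), (0, 1)}"

definition delta2_free :: "(real \<times> real) set \<Rightarrow> bool" where
  "delta2_free K \<longleftrightarrow> \<not> (\<exists>T. unimodular_map T \<and> T ` std_simplex \<subseteq> rel_interior K)"

definition unimod_equiv :: "(real \<times> real) set \<Rightarrow> (real \<times> real) set \<Rightarrow> bool" where
  "unimod_equiv X Y \<longleftrightarrow> (\<exists>T. unimodular_map T \<and> T ` X = Y)"

definition lattice_width :: "(real \<times> real) set \<Rightarrow> real" where
  "lattice_width K = (INF u \<in> {u :: int \<times> int. u \<noteq> (0, 0)}.
      (SUP xy \<in> K \<times> K. \<bar>of_int (fst u) * (fst (fst xy) - fst (snd xy))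
                          + of_int (snd u) * (snd (fst xy) - snd (snd xy))\<bar>))"

definition special_triangle :: "(real \<times> real) set" where
  "special_triangle = convex hull {(1/3, 5/3), (-4/3, -5/3), (2, 0)}"

end

theory Submission
  imports Defs
begin

text \<open>
  A unimodular map sends two neighbouring interior lattice points to \<open>(0, 0)\<close> and \<open>(1, 0)\<close>; being
  free of unimodular triangles then forces the interior to miss all points \<open>(m, 1)\<close> and \<open>(m, -1)\<close>.
  If \<open>P\<close> has height at least \<open>10/3\<close> and reaches beyond both lines \<open>y = 1\<close> and \<open>y = -1\<close>, its sections
  there lie in \<open>[m, m + 1]\<close> and \<open>[n, n + 1]\<close>. A (half-integral) shear centres both sections at
  \<open>[-1/2, 1/2]\<close>, and the interior lattice points become \<open>(k - 1/2, 0)\<close> and \<open>(k + 1/2, 0)\<close> with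
  \<open>k = -(m + n)/2\<close>. By reflection \<open>k \<ge> 0\<close>. Lines through the highest and the lowest point and the
  ends of the two sections confine \<open>P\<close>, which rules out \<open>k \<ge> 3/2\<close> and bounds the width in a direction
  \<open>x\<close> or \<open>x + y\<close> for \<open>k = 0, 1\<close> strictly below \<open>10/3\<close>. For \<open>k = 1/2\<close> the direction \<open>x + y/2\<close> of the
  centred coordinates is integral in the original ones; if the part above \<open>y = 1\<close> is at least as high as
  the part below \<open>y = -1\<close>, the width in it is at most \<open>10/3\<close>, and the case of equality pins down the
  three vertices.
\<close>

section \<open>Inequalities\<close>

text \<open>For \<open>p = q = 1\<close> and \<open>e = 0\<close> the inequality of
  \<open>steep_bound\<close> says that this polynomial is nonnegative. The grouping
  \<open>low\<close> rests on \<open>4/3 \<le> a + b\<close> and serves for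
  \<open>b \<le> 2/3\<close>, the grouping \<open>high\<close> rests on \<open>b \<le> a\<close> and
  serves for larger \<open>b\<close>; their terms all vanish only at
  \<open>a = b = 2/3\<close>.\<close>

lemma height_polynomial:
  fixes a b :: real
  assumes "b \<le> a" "4/3 \<le> a + b" "b \<le> 2"
  shows "0 \<le> a * (7/3 - b/2) + b * (4/3 - b/2) - 2" (is "0 \<le> ?f")
    and "a * (7/3 - b/2) + b * (4/3 - b/2) - 2 = 0 \<Longrightarrow> a = 2/3 \<and> b = 2/3"
    and "2/3 \<le> b \<Longrightarrow> (b - 2/3) * (3 - b) \<le> a * (7/3 - b/2) + b * (4/3 - b/2) - 2"
proof -
  have low: "?f = (a + b - 4/3) * (7/3 - b/2) + 5/3 * (2/3 - b)"
    by (simp add: field_simps)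
  have high: "?f = (a - b) * (7/3 - b/2) + (b - 2/3) * (3 - b)"
    by (simp add: field_simps)
  have n1: "0 \<le> (a + b - 4/3) * (7/3 - b/2)" "0 \<le> (a - b) * (7/3 - b/2)"
    using assms by (auto intro!: mult_nonneg_nonneg)
  have n2: "0 \<le> (b - 2/3) * (3 - b)" if "2/3 \<le> b"
    using assms that by (auto intro!: mult_nonneg_nonneg)
  show "0 \<le> ?f"
  proof (cases "b \<le> 2/3")
    case True
    then have "0 \<le> 5/3 * (2/3 - b)" by simp
    then show ?thesis unfolding low using n1(1) by (rule add_nonneg_nonneg[rotated])
  next
    case False
    then show ?thesis unfolding high using n1(2) n2 by (intro add_nonneg_nonneg) auto
  qed
  show "a = 2/3 \<and> b = 2/3" if "?f = 0"
  proof (cases "b \<le> 2/3")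
    case True
    then have "(a + b - 4/3) * (7/3 - b/2) = 0 \<and> 5/3 * (2/3 - b) = 0"
      using that n1(1) unfolding low by (subst add_nonneg_eq_0_iff[symmetric]) auto
    then show ?thesis by auto
  next
    case False
    then have "(a - b) * (7/3 - b/2) = 0 \<and> (b - 2/3) * (3 - b) = 0"
      using that n1(2) n2 unfolding high by (subst add_nonneg_eq_0_iff[symmetric]) auto
    then show ?thesis using assms False by auto
  qed
  show "(b - 2/3) * (3 - b) \<le> ?f"
    unfolding high using n1(2) by simp
qed

text \<open>The sharp bound is a weighted harmonic mean of \<open>p\<close> and \<open>q\<close>; the arithmetic mean is used instead
  because bounds for the two sides of a body can then simply be added.\<close>

lemma harmonic_bound:
  fixes r y a b p q :: real
  assumes "0 < a" "0 < b" "0 \<le> p" "0 \<le> q" "-1 \<le> y" "y \<le> 1"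
    and 1: "r * a \<le> (1 - y) * p" and 2: "r * b \<le> (1 + y) * q"
  shows "r \<le> 2 * (a * p + b * q) / (a + b)\<^sup>2"
proof (cases "r \<le> 0")
  case True
  have "0 \<le> 2 * (a * p + b * q) / (a + b)\<^sup>2"
    using assms by auto
  then show ?thesis using True by linarith
next
  case False
  then have "0 < (1 - y) * p" "0 < (1 + y) * q"
    using 1 2 assms by (smt (verit) mult_pos_pos)+
  then have y: "0 < 1 - y" "0 < 1 + y"
    using assms by (auto simp: zero_less_mult_iff)
  have "r * a * a * (1 + y) \<le> (1 - y) * p * a * (1 + y)"
    using 1 y assms by (simp add: mult_right_mono)
  moreover have "r * b * b * (1 - y) \<le> (1 + y) * q * b * (1 - y)"
    using 2 y assms by (simp add: mult_right_mono)
  \<comment> \<open>This is Cauchy-Schwarz with the weights \<open>1 - y\<close> and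
    \<open>1 + y\<close> of sum 2,
    \<open>(a + b)^2 \<le> 2 * (a^2 / (1 - y) + b^2 / (1 + y))\<close>, with denominators
    cleared.\<close>
  moreover have "0 \<le> r * (a * (1 + y) - b * (1 - y))\<^sup>2"
    using False by simp
  ultimately have "r * (a + b)\<^sup>2 * ((1 - y) * (1 + y)) \<le> 2 * (a * p + b * q) * ((1 - y) * (1 + y))"
    by (simp add: power2_eq_square algebra_simps)
  then have "r * (a + b)\<^sup>2 \<le> 2 * (a * p + b * q)"
    using y by (simp add: mult_le_cancel_right)
  then show ?thesis
    using assms by (simp add: field_simps)
qed

text \<open>The polynomial cores of the case \<open>k = 1/2\<close>: \<open>steep_bound\<close> when the highest point lies at or to the
  left of \<open>x = -1/2\<close>, \<open>shallow_bound\<close> otherwise. Equality is possible only in the former.\<close>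

lemma steep_bound:
  fixes a b p q e :: real
  assumes "0 < b" "b \<le> a" "4/3 \<le> a + b" "1 \<le> p" "a/2 < p" "b/2 < q"
    and c: "(p - 1) * (2 + b) \<le> a * (1 - q)"
    and e: "e * a = (p - 1) * (2 + b)"
  shows "(2 * p - a) * q \<le> (a * q + b * p) * (4/3 - b/2 + e)"
    and "(2 * p - a) * q = (a * q + b * p) * (4/3 - b/2 + e)
      \<Longrightarrow> a = 2/3 \<and> b = 2/3 \<and> p = 1 \<and> q = 1"
proof -
  have a: "0 < a" using assms by linarith
  have "0 \<le> (p - 1) * (2 + b)" using assms by simp
  then have q1: "q \<le> 1" using c a by (smt (verit) mult_pos_neg)
  have e0: "0 \<le> e" using e a \<open>0 \<le> (p - 1) * (2 + b)\<close> by (metis zero_le_mult_iff less_le_not_le mult.commute)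
  \<comment> \<open>Inserting \<open>a/2 < p\<close> and \<open>b/2 < q\<close> into the chord
    condition \<open>c\<close> bounds \<open>a * b\<close>; with \<open>b \<le> a\<close> this
    becomes a quadratic inequality in \<open>b\<close> alone.\<close>
  have "(a/2 - 1) * (2 + b) \<le> (p - 1) * (2 + b)" "a * (1 - q) \<le> a * (1 - b/2)"
    using assms a by (auto intro!: mult_right_mono mult_left_mono)
  then have "a * b \<le> 2 + b" using c by (simp add: algebra_simps)
  moreover have "b * b \<le> a * b" using assms by simp
  ultimately have "(b - 2) * (b + 1) \<le> 0" by (simp add: algebra_simps)
  then have b2: "b \<le> 2" using assms by (smt (verit) mult_pos_pos)
  let ?f = "a * (7/3 - b/2) + b * (4/3 - b/2) - 2"
  note f = height_polynomial[OF assms(2,3) b2]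
  \<comment> \<open>The gap splits into four nonnegative terms. Equality kills the first two, hence
    \<open>a = b = 2/3\<close> and \<open>p = q\<close>, and \<open>q \<le> 1 \<le> p\<close> does
    the rest.\<close>
  have "(a * q + b * p) * (4/3 - b/2 + e) - (2 * p - a) * q
     = q * ?f + b * (p - q) * (4/3 - b/2) + b * p * e + q * (e * a - 2 * (p - 1))"
    by (simp add: field_simps)
  also have "q * (e * a - 2 * (p - 1)) = q * ((p - 1) * b)"
    unfolding e by (simp add: algebra_simps)
  finally have diff: "(a * q + b * p) * (4/3 - b/2 + e) - (2 * p - a) * q
     = q * ?f + b * (p - q) * (4/3 - b/2) + b * p * e + q * ((p - 1) * b)" .
  have "0 \<le> q * ?f" "0 \<le> b * (p - q) * (4/3 - b/2)" "0 \<le> b * p * e" "0 \<le> q * ((p - 1) * b)"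
    using f(1) assms q1 e0 b2 by (auto intro!: mult_nonneg_nonneg)
  note nn = this
  show "(2 * p - a) * q \<le> (a * q + b * p) * (4/3 - b/2 + e)"
  proof -
    have "0 \<le> (a * q + b * p) * (4/3 - b/2 + e) - (2 * p - a) * q"
      unfolding diff using nn by (intro add_nonneg_nonneg)
    then show ?thesis by simp
  qed
  assume "(2 * p - a) * q = (a * q + b * p) * (4/3 - b/2 + e)"
  then have "q * ?f + b * (p - q) * (4/3 - b/2) + b * p * e + q * ((p - 1) * b) = 0"
    unfolding diff[symmetric] by simp
  then have "q * ?f = 0" "b * (p - q) * (4/3 - b/2) = 0"
    using nn by (simp_all add: add_nonneg_eq_0_iff)
  then show "a = 2/3 \<and> b = 2/3 \<and> p = 1 \<and> q = 1"
    using f(2) assms q1 b2 by auto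
qed

lemma shallow_bound:
  fixes a b p q e :: real
  assumes "0 < b" "b \<le> a" "4/3 \<le> a + b" "p < 1" "a/2 < p" "b/2 < q"
    and e: "e * (2 + a) = (1 - p) * b" and q: "q \<le> 1 + e"
  shows "(2 * p - a) * q < (a * q + b * p) * (4/3 - b/2 - e)"
    and "0 \<le> e"
proof -
  define u where "u = 1 - p"
  have u: "0 < u" "u < 1 - a/2" "u \<le> 1" "p = 1 - u" using assms by (auto simp: u_def)
  have a: "0 < a" "a < 2" and b2: "b < 2" using assms by linarith+
  have eu: "e * (2 + a) = u * b" using e by (simp add: u_def)
  have "0 \<le> e * (2 + a)" unfolding eu using u assms by simp
  then show e0: "0 \<le> e" using a by (simp add: zero_le_mult_iff)
  have "u * b \<le> (1 - a/2) * b" using u assms by (intro mult_right_mono) auto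
  then have "(b/2 + e) * (2 + a) \<le> 2 * b"
    using eu by (simp add: algebra_simps add_divide_distrib)
  also have "\<dots> \<le> 1 * (2 + a)" using assms a b2 by simp
  finally have "b/2 + e \<le> 1" using a by (simp add: mult_le_cancel_right)
  then have C: "0 < 4/3 - b/2 - e" by simp
  \<comment> \<open>The gap is affine in \<open>q\<close> with slope \<open>A\<close> and a positive
    constant term, so only for \<open>A < 0\<close> must \<open>q\<close> be replaced by its upper
    bound \<open>1 + e\<close>.\<close>
  define A where "A = a * (7/3 - b/2 - e) - 2 * p"
  have diff: "(a * q + b * p) * (4/3 - b/2 - e) - (2 * p - a) * q = q * A + b * p * (4/3 - b/2 - e)"
    unfolding A_def by (simp add: field_simps)
  have pos: "0 < b * p * (4/3 - b/2 - e)"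
    using C assms a by (intro mult_pos_pos) auto
  show "(2 * p - a) * q < (a * q + b * p) * (4/3 - b/2 - e)"
  proof (cases "0 \<le> A")
    case True
    then have "0 \<le> q * A" using assms by simp
    then have "0 < q * A + b * p * (4/3 - b/2 - e)" using pos by (rule add_nonneg_pos)
    then show ?thesis unfolding diff[symmetric] by simp
  next
    case False
    then have qA: "(1 + e) * A \<le> q * A" using q by (simp add: mult_le_cancel_right)
    let ?f = "a * (7/3 - b/2) + b * (4/3 - b/2) - 2"
    have b2': "b \<le> 2" using b2 by simp
    note f = height_polynomial[OF assms(2,3) b2']
    have id: "(1 + e) * A + b * p * (4/3 - b/2 - e) =
      ?f + u * (2 - 7/3 * b + b\<^sup>2/2) + b * u * e + e * (2 * u - a * e) + a * e * (4/3 - b/2)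
        + (u * b - e * (2 + b))"
      unfolding A_def u(4) by (simp add: field_simps power2_eq_square)
    have "a * b \<le> a * 2" using b2 a by (intro mult_left_mono) auto
    then have "a * b \<le> 2 + a" using a by linarith
    then have "u * (a * b) \<le> u * (2 + a)" using u by (intro mult_left_mono) auto
    with _ have "(a * e) * (2 + a) \<le> u * (2 + a)"
      by (rule ord_eq_le_trans) (simp add: mult.assoc eu mult.left_commute)
    then have ae: "a * e \<le> u" using a by (simp add: mult_le_cancel_right)
    have "e * (2 + b) \<le> e * (2 + a)" using e0 assms by (intro mult_left_mono) auto
    then have t4: "0 \<le> u * b - e * (2 + b)" using eu by linarith
    have t: "0 \<le> b * u * e" "0 \<le> e * (2 * u - a * e)" "0 \<le> a * e * (4/3 - b/2)"
      using e0 u a b2 assms ae by (auto intro!: mult_nonneg_nonneg)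
    \<comment> \<open>The sum is affine in \<open>u\<close> on \<open>[0, 1]\<close> and equals
      \<open>?f\<close>, which is nonnegative, at \<open>u = 0\<close>. For
      \<open>b \<le> 2/3\<close> its slope is positive; otherwise the third bound of
      \<open>height_polynomial\<close> makes its value at \<open>u = 1\<close> positive.\<close>
    have "0 < ?f + u * (2 - 7/3 * b + b\<^sup>2/2)"
    proof (cases "b \<le> 2/3")
      case True
      have "0 \<le> b\<^sup>2/2" by simp
      then have "0 < 2 - 7/3 * b + b\<^sup>2/2" using True by linarith
      then have "0 < u * (2 - 7/3 * b + b\<^sup>2/2)" using u by simp
      then show ?thesis using f(1) by linarith
    next
      case False
      have "0 < b * (4/3 - b/2)" using assms b2 by simp
      also have "\<dots> = (b - 2/3) * (3 - b) + (2 - 7/3 * b + b\<^sup>2/2)"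
        by (simp add: field_simps power2_eq_square)
      also have "\<dots> \<le> ?f + (2 - 7/3 * b + b\<^sup>2/2)" using f(3) False by simp
      finally have "0 < u * (?f + (2 - 7/3 * b + b\<^sup>2/2))" using u by simp
      moreover have "0 \<le> (1 - u) * ?f" using f(1) u by simp
      moreover have "F + u * c = (1 - u) * F + u * (F + c)" for F c
        by (simp add: algebra_simps)
      ultimately show ?thesis by (metis add_nonneg_pos)
    qed
    from add_pos_nonneg[OF add_pos_nonneg[OF add_pos_nonneg[OF add_pos_nonneg[OF this t(1)] t(2)] t(3)] t4]
    have "0 < (1 + e) * A + b * p * (4/3 - b/2 - e)"
      unfolding id .
    also have "\<dots> \<le> q * A + b * p * (4/3 - b/2 - e)" using qA by simp
    finally show ?thesis unfolding diff[symmetric] by simp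
  qed
qed

section \<open>Bodies with centred sections\<close>

text \<open>
  \<open>Q\<close> is the centred body: \<open>upper\<close> and \<open>lower\<close> are what convexity yields when the sections at \<open>y = 1\<close>
  and \<open>y = -1\<close> lie in \<open>[-1/2, 1/2]\<close>. Its highest point is \<open>(1/2 - p, 1 + a)\<close>, its lowest
  \<open>(1/2 - q, -1 - b)\<close>. The slack \<open>\<epsilon>\<close> records that \<open>(k + 1/2, 0)\<close> is an interior point.
\<close>

locale centred_sections =
  fixes Q :: "(real \<times> real) set" and k a b p q \<epsilon> :: real
  assumes upper: "\<And>x1 y1 x2 y2. (x1, y1) \<in> Q \<Longrightarrow> (x2, y2) \<in> Q \<Longrightarrow> y1 \<le> 1 \<Longrightarrow> 1 \<le> y2 \<Longrightarrow> y1 < y2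
      \<Longrightarrow> \<bar>x1 * (y2 - 1) + x2 * (1 - y1)\<bar> \<le> (y2 - y1) / 2"
    and lower: "\<And>x1 y1 x2 y2. (x1, y1) \<in> Q \<Longrightarrow> (x2, y2) \<in> Q \<Longrightarrow> y1 \<le> -1 \<Longrightarrow> -1 \<le> y2 \<Longrightarrow> y1 < y2
      \<Longrightarrow> \<bar>x1 * (y2 + 1) + x2 * (-1 - y1)\<bar> \<le> (y2 - y1) / 2"
    and top: "(1/2 - p, 1 + a) \<in> Q" and bottom: "(1/2 - q, -1 - b) \<in> Q"
    and height: "\<And>x y. (x, y) \<in> Q \<Longrightarrow> -1 - b \<le> y \<and> y \<le> 1 + a"
    and left: "(k - 1/2, 0) \<in> Q" and right: "(k + 1/2 + \<epsilon>, 0) \<in> Q" and eps: "0 < \<epsilon>"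
    and b_pos: "0 < b" and ba: "b \<le> a" and tall: "4/3 \<le> a + b"
begin

section \<open>Confinement of the body by lines through its highest and lowest point\<close>

lemma a_pos: "0 < a" and a_ge: "2/3 \<le> a"
  using b_pos ba tall by linarith+

text \<open>The segment to the highest point crosses \<open>y = 1\<close> inside
  \<open>[-1/2, 1/2]\<close>, so the point lies between the lines from the highest point through the
  two ends of the section.\<close>

lemma from_top:
  assumes "(x, y) \<in> Q" "y \<le> 1"
  shows "(x - 1/2) * a \<le> (1 - y) * p" "(-1/2 - x) * a \<le> (1 - y) * (1 - p)"
  using upper[OF assms(1) top assms(2)] assms(2) a_pos
  by (auto simp: abs_le_iff field_simps)

lemma from_bottom:
  assumes "(x, y) \<in> Q" "-1 \<le> y"
  shows "(x - 1/2) * b \<le> (1 + y) * q" "(-1/2 - x) * b \<le> (1 + y) * (1 - q)"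
  using lower[OF bottom assms(1)] assms(2) b_pos
  by (auto simp: abs_le_iff field_simps)

text \<open>The segments down to \<open>right\<close>, \<open>left\<close> and the lowest point
  cross \<open>y = 1\<close> inside the section. The slack \<open>\<epsilon>\<close> makes the first
  bound strict for \<open>y > 1\<close>.\<close>

lemma upper_part:
  assumes "(x, y) \<in> Q" "1 \<le> y"
  shows "x \<le> 1/2 - k * (y - 1) - \<epsilon> * (y - 1)" "-1/2 - k * (y - 1) \<le> x"
    "(-1/2 - x) * (2 + b) \<le> (y - 1) * (1 - q)"
  using upper[OF right assms(1)] upper[OF left assms(1)] upper[OF bottom assms(1)] assms(2) b_pos
  by (auto simp: abs_le_iff field_simps)

lemma lower_part:
  assumes "(x, y) \<in> Q" "y \<le> -1"
  shows "x \<le> 1/2 - k * (-1 - y) - \<epsilon> * (-1 - y)" "-1/2 - k * (-1 - y) \<le> x"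
    "(-1/2 - x) * (2 + a) \<le> (-1 - y) * (1 - p)"
  using lower[OF assms(1) right] lower[OF assms(1) left] lower[OF assms(1) top] assms(2) a_pos
  by (auto simp: abs_le_iff field_simps)

lemma p_gt: "k * a < p" and p_le: "p \<le> 1 + k * a"
  and q_gt: "k * b < q" and q_le: "q \<le> 1 + k * b"
proof -
  have "0 < \<epsilon> * a" "0 < \<epsilon> * b" using eps a_pos b_pos by auto
  then show "k * a < p" "k * b < q" "p \<le> 1 + k * a" "q \<le> 1 + k * b"
    using upper_part[OF top] lower_part[OF bottom] a_pos b_pos by auto
qed

text \<open>The chord from the highest to the lowest point must cross \<open>y = 1\<close> no
  further left than \<open>x = -1/2\<close>; this couples \<open>p\<close> and
  \<open>q\<close>.\<close>

lemma chord_top: "(p - 1) * (2 + b) \<le> a * (1 - q)"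
  using upper_part(3)[OF top] a_pos by auto

lemma chord_bottom: "(q - 1) * (2 + a) \<le> b * (1 - p)"
  using lower_part(3)[OF bottom] b_pos by auto

lemma mid_right:
  assumes "(x, y) \<in> Q" "-1 \<le> y" "y \<le> 1" "0 \<le> k"
  shows "x - 1/2 \<le> 2 * (a * p + b * q) / (a + b)\<^sup>2"
proof -
  have "0 \<le> p" "0 \<le> q" using p_gt q_gt assms(4) a_pos b_pos by (smt (verit) mult_nonneg_nonneg)+
  then show ?thesis using assms a_pos b_pos
    by (intro harmonic_bound[of a b _ _ y] from_top from_bottom) auto
qed

lemma mid_left:
  assumes "(x, y) \<in> Q" "-1 \<le> y" "y \<le> 1" "p \<le> 1" "q \<le> 1"
  shows "-1/2 - x \<le> 2 * (a * (1 - p) + b * (1 - q)) / (a + b)\<^sup>2"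
  using assms a_pos b_pos by (intro harmonic_bound[of a b _ _ y] from_top from_bottom) auto

text \<open>For \<open>k \<ge> 0\<close> the parts above \<open>y = 1\<close> and below
  \<open>y = -1\<close> lean to the left, so only the strip between can reach beyond
  \<open>x = 1/2\<close>.\<close>

lemma far_right:
  assumes "(x, y) \<in> Q" "0 \<le> k"
  shows "x \<le> 1/2 \<or> -1 \<le> y \<and> y \<le> 1"
proof (rule ccontr)
  assume n: "\<not> ?thesis"
  then consider "1 < y" | "y < -1" by linarith
  then show False
  proof cases
    case 1
    then have "0 \<le> k * (y - 1)" "0 \<le> \<epsilon> * (y - 1)" using eps assms by auto
    then show False using 1 n upper_part[OF assms(1)] by linarith
  next
    case 2
    then have "0 \<le> k * (-1 - y)" "0 \<le> \<epsilon> * (-1 - y)" using eps assms by auto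
    then show False using 2 n lower_part[OF assms(1)] by linarith
  qed
qed

lemma right_bound:
  assumes "(x, y) \<in> Q" "0 \<le> k"
  shows "x - 1/2 \<le> 2 * (a * p + b * q) / (a + b)\<^sup>2"
proof -
  have "0 \<le> p" "0 \<le> q" using p_gt q_gt assms(2) a_pos b_pos by (smt (verit) mult_nonneg_nonneg)+
  then have "0 \<le> 2 * (a * p + b * q) / (a + b)\<^sup>2" using a_pos b_pos by auto
  then show ?thesis using far_right[OF assms] mid_right[OF assms(1) _ _ assms(2)] by linarith
qed

text \<open>If \<open>1 \<le> p\<close>, the highest point is not to the right of
  \<open>x = -1/2\<close>, so the line from it through \<open>(-1/2, 1)\<close> does not go left on
  its way down. The lowest point serves likewise if \<open>1 \<le> q\<close>.\<close>

lemma mid_left_nonpos: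
  assumes "(x, y) \<in> Q" "-1 \<le> y" "y \<le> 1" "1 \<le> p \<or> 1 \<le> q"
  shows "-1/2 \<le> x"
proof (cases "1 \<le> p")
  case True
  then have "(1 - y) * (1 - p) \<le> 0" using assms by (intro mult_nonneg_nonpos) auto
  then have "(-1/2 - x) * a \<le> 0" using from_top[OF assms(1,3)] by linarith
  then show ?thesis using a_pos by (simp add: mult_le_0_iff)
next
  case False
  then have "(1 + y) * (1 - q) \<le> 0" using assms by (intro mult_nonneg_nonpos) auto
  then have "(-1/2 - x) * b \<le> 0" using from_bottom[OF assms(1,2)] by linarith
  then show ?thesis using b_pos by (simp add: mult_le_0_iff)
qed

text \<open>The overhangs of the strip on the right and on the left of \<open>[-1/2, 1/2]\<close>
  have bounds whose sum is free of \<open>p\<close> and \<open>q\<close>; with the section of length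
  1 this yields a total of at most \<open>5/2\<close>.\<close>

lemma harmonic_sum:
  "2 * (a * p + b * q) / (a + b)\<^sup>2 + 2 * (a * (1 - p) + b * (1 - q)) / (a + b)\<^sup>2 = 2 / (a + b)"
  "2 / (a + b) \<le> 3/2"
proof -
  have "a + b \<noteq> 0" using a_pos b_pos by simp
  then have "2 / (a + b) = 2 * (a + b) / (a + b)\<^sup>2"
    unfolding power2_eq_square by (rule nonzero_mult_divide_mult_cancel_right[symmetric])
  also have "2 * (a + b) = 2 * (a * p + b * q) + 2 * (a * (1 - p) + b * (1 - q))"
    by (simp add: algebra_simps)
  finally show "2 * (a * p + b * q) / (a + b)\<^sup>2 + 2 * (a * (1 - p) + b * (1 - q)) / (a + b)\<^sup>2 = 2 / (a + b)"
    by (simp add: add_divide_distrib)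
  show "2 / (a + b) \<le> 3/2" using tall by (simp add: field_simps)
qed

section \<open>Bound on the slope, and the width for \<open>k = 0\<close>\<close>

lemma slope_bound: "k < 3/2"
proof (rule ccontr)
  assume "\<not> k < 3/2"
  then have "3/2 * a \<le> k * a" "3/2 * b \<le> k * b" using a_pos b_pos by auto
  then have pq: "3/2 * a < p" "3/2 * b < q" using p_gt q_gt by linarith+
  then have "(3/2 * a - 1) * (2 + b) < (p - 1) * (2 + b)" "a * (1 - q) < a * (1 - 3/2 * b)"
    using a_pos b_pos by auto
  \<comment> \<open>For such \<open>k\<close> the highest and the lowest point are so far left that
    \<open>chord_top\<close> bounds \<open>a\<close> and \<open>b\<close> too severely for
    \<open>b \<le> a\<close> and \<open>4/3 \<le> a + b\<close>.\<close>
  then have 1: "2 * a + 3 * (a * b) - b < 2" using chord_top by (simp add: algebra_simps)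
  show False
  proof (cases "2/3 \<le> b")
    case True
    then have "2/3 * b \<le> b * b" "b * b \<le> a * b" using ba b_pos by auto
    then show False using 1 True ba by linarith
  next
    case False
    have "(4/3 - b) * b \<le> a * b" using tall b_pos by (intro mult_right_mono) auto
    moreover have "b * b \<le> 2/3 * b" using False b_pos by (intro mult_right_mono) auto
    moreover have "(4/3 - b) * b = 4/3 * b - b * b" by (simp add: algebra_simps)
    moreover have "0 < (2/3 - b) * (b + 1/3)" using False b_pos by simp
    then have "b * b < 1/3 * b + 2/9" by (simp add: algebra_simps)
    ultimately show False using 1 tall by linarith
  qed
qed

lemma width_slope_zero:
  assumes "k = 0" "(x, y) \<in> Q" "(x', y') \<in> Q"
  shows "x - x' < 10/3"
proof -
  have pq: "0 \<le> p" "p \<le> 1" "0 \<le> q" "q \<le> 1" using assms(1) p_gt p_le q_gt q_le by auto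
  have nn: "0 \<le> 2 * (a * p + b * q) / (a + b)\<^sup>2" "0 \<le> 2 * (a * (1 - p) + b * (1 - q)) / (a + b)\<^sup>2"
    using pq a_pos b_pos by auto
  have "x - 1/2 \<le> 2 * (a * p + b * q) / (a + b)\<^sup>2"
    using right_bound[OF assms(2)] assms(1) by simp
  moreover have "-1/2 - x' \<le> 2 * (a * (1 - p) + b * (1 - q)) / (a + b)\<^sup>2"
    using mid_left[OF assms(3)] upper_part(2)[OF assms(3)] lower_part(2)[OF assms(3)] nn assms(1) pq
    by (cases "1 \<le> y'"; cases "y' \<le> -1"; force)
  ultimately show ?thesis using harmonic_sum by linarith
qed

section \<open>The width in the direction \<open>x + y/2\<close> for \<open>k = 1/2\<close>\<close>

lemma half_facts:
  assumes "k = 1/2"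
  shows "a/2 < p" "b/2 < q" "p \<le> 1 + a/2" "0 < a * q + b * p"
proof -
  show pq: "a/2 < p" "b/2 < q" "p \<le> 1 + a/2" using p_gt q_gt p_le assms by auto
  then show "0 < a * q + b * p" using a_pos b_pos by (simp add: add_pos_pos)
qed

lemma half_upper:
  assumes "k = 1/2" "(x, y) \<in> Q" "1 \<le> y"
  shows "x + y/2 \<le> 1 - \<epsilon> * (y - 1)" "0 \<le> x + y/2"
  using upper_part(1,2)[OF assms(2,3)] by (simp_all add: assms(1) field_simps)

lemma half_lower:
  assumes "k = 1/2" "(x, y) \<in> Q" "y \<le> -1"
  shows "x - y/2 \<le> 1 - \<epsilon> * (-1 - y)"
  using lower_part(1)[OF assms(2,3)] by (simp add: assms(1) field_simps)

lemma half_right: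
  assumes "k = 1/2" "(x, y) \<in> Q"
  shows "x + y/2 \<le> 1 + (2 * p - a) * q / (a * q + b * p)"
proof -
  note h = half_facts[OF assms(1)]
  have D: "0 < a * q + b * p" by (rule h)
  have z: "0 \<le> (2 * p - a) * q / (a * q + b * p)"
    using h a_pos b_pos by (intro divide_nonneg_pos mult_nonneg_nonneg) auto
  consider "1 \<le> y" | "y \<le> -1" | "-1 \<le> y" "y \<le> 1" by linarith
  then show ?thesis
  proof cases
    case 1
    then have "0 \<le> \<epsilon> * (y - 1)" using eps by simp
    then have "x + y/2 \<le> 1" using half_upper(1)[OF assms(1,2) 1] by linarith
    then show ?thesis using z by (rule add_increasing2[rotated])
  next
    case 2
    then have "0 \<le> \<epsilon> * (-1 - y)" using eps by simp
    then have "x + y/2 \<le> 1" using half_lower[OF assms(1,2) 2] 2 by linarith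
    then show ?thesis using z by (rule add_increasing2[rotated])
  next
    case 3
    \<comment> \<open>Under the bounds from the highest and the lowest point, \<open>x + y/2\<close>
      is largest where the two bounding lines meet. The factors \<open>q + b/2\<close> and
      \<open>p - a/2\<close> are the multipliers that combine the bounds into one on
      \<open>x + y/2\<close>.\<close>
    have "(x - 1/2) * a * (q + b/2) \<le> (1 - y) * p * (q + b/2)"
      using from_top(1)[OF assms(2) 3(2)] h b_pos by (intro mult_right_mono) auto
    moreover have "(x - 1/2) * b * (p - a/2) \<le> (1 + y) * q * (p - a/2)"
      using from_bottom(1)[OF assms(2) 3(1)] h by (intro mult_right_mono) auto
    ultimately have "(x - 1/2) * a * (q + b/2) + (x - 1/2) * b * (p - a/2)
        \<le> (1 - y) * p * (q + b/2) + (1 + y) * q * (p - a/2)" by (rule add_mono)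
    also have "(x - 1/2) * a * (q + b/2) + (x - 1/2) * b * (p - a/2) = (x - 1/2) * (a * q + b * p)"
      by (simp add: algebra_simps)
    also have "(1 - y) * p * (q + b/2) + (1 + y) * q * (p - a/2)
        = (2 * p - a) * q + (1 - y)/2 * (a * q + b * p)"
      by (simp add: field_simps)
    finally have "(x - 1/2) * (a * q + b * p) - (1 - y)/2 * (a * q + b * p) \<le> (2 * p - a) * q"
      by simp
    then have "(x + y/2 - 1) * (a * q + b * p) \<le> (2 * p - a) * q"
      by (simp add: field_simps)
    then have "x + y/2 - 1 \<le> (2 * p - a) * q / (a * q + b * p)"
      using D by (simp add: pos_le_divide_eq)
    then show ?thesis by simp
  qed
qed

lemma half_left_steep:
  assumes "k = 1/2" "1 \<le> p" "(x, y) \<in> Q"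
  shows "-(x + y/2) \<le> 1 + b/2 - (p - 1) * (2 + b) / a"
proof -
  note h = half_facts[OF assms(1)]
  have "a * (1 - q) \<le> a" using h a_pos b_pos by simp
  then have e: "(p - 1) * (2 + b) / a \<le> 1" using chord_top a_pos by (simp add: field_simps)
  show ?thesis
  proof (cases "1 \<le> y")
    case True
    then have "-(x + y/2) \<le> 0" using half_upper(2)[OF assms(1,3) True] by linarith
    also have "0 \<le> 1 + b/2 - (p - 1) * (2 + b) / a" using e b_pos by simp
    finally show ?thesis .
  next
    case False
    \<comment> \<open>The extreme corner is where the line from the highest point through
      \<open>(-1/2, 1)\<close> meets \<open>y = -1 - b\<close>; \<open>p \<le> 1 + a/2\<close> makes
      the multiplier of the height bound nonnegative.\<close>
    have "0 \<le> (a/2 - (p - 1)) * (y + 1 + b)"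
      using h height[OF assms(3)] by (intro mult_nonneg_nonneg) auto
    moreover have "(-1/2 - x) * a \<le> (1 - y) * (1 - p)" using from_top(2)[OF assms(3)] False by simp
    ultimately have "-(x + y/2) * a \<le> a * (1 + b/2) - (p - 1) * (2 + b)"
      by (simp add: algebra_simps add_divide_distrib)
    then show ?thesis using a_pos by (simp add: field_simps)
  qed
qed

lemma half_left_lower:
  assumes "k = 1/2" "p < 1" "(x, y) \<in> Q" "y \<le> -1"
  shows "-(x + y/2) \<le> 1 + b/2 + (1 - p) * b / (2 + a)"
proof -
  have "(-1 - y) * (1 - p) \<le> b * (1 - p)"
    using height[OF assms(3)] assms(2) by (intro mult_right_mono) auto
  then have "(-1/2 - x) * (2 + a) \<le> (1 - p) * b" using lower_part(3)[OF assms(3,4)] by (simp add: mult.commute)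
  then have "-1/2 - x \<le> (1 - p) * b / (2 + a)" using a_pos by (simp add: pos_le_divide_eq)
  then show ?thesis using height[OF assms(3)] by simp
qed

lemma width_slope_half:
  assumes k: "k = 1/2" and Q: "(x, y) \<in> Q" "(x', y') \<in> Q"
  shows "x + y/2 - (x' + y'/2) < 10/3 \<or>
    a = 2/3 \<and> b = 2/3 \<and> p = 1 \<and> q = 1 \<and> (2, 0) \<in> Q"
proof -
  note h = half_facts[OF k]
  \<comment> \<open>\<open>1 + Z\<close> is the value of \<open>x + y/2\<close> at the right corner.
    The left bound is \<open>1 + b/2 - e\<close> for \<open>1 \<le> p\<close>, and
    \<open>1 + b/2 + e\<close> below \<open>y = -1\<close> for \<open>p < 1\<close>. A total of
    \<open>10/3\<close> thus corresponds to \<open>Z = 4/3 - b/2 + e\<close> and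
    \<open>Z = 4/3 - b/2 - e\<close>, the thresholds in \<open>steep_bound\<close> and
    \<open>shallow_bound\<close>.\<close>
  define Z where "Z = (2 * p - a) * q / (a * q + b * p)"
  have R: "x + y/2 \<le> 1 + Z" unfolding Z_def by (rule half_right[OF k Q(1)])
  show ?thesis
  proof (cases "1 \<le> p")
    case True
    define e where "e = (p - 1) * (2 + b) / a"
    have e: "e * a = (p - 1) * (2 + b)" using a_pos by (simp add: e_def)
    note st = steep_bound[OF b_pos ba tall True h(1,2) chord_top e]
    have L: "-(x' + y'/2) \<le> 1 + b/2 - e" unfolding e_def by (rule half_left_steep[OF k True Q(2)])
    have Z: "Z \<le> 4/3 - b/2 + e"
      using st(1) h(4) by (simp add: Z_def pos_divide_le_eq mult.commute)
    show ?thesis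
    proof (rule disjCI)
      assume n: "\<not> (a = 2/3 \<and> b = 2/3 \<and> p = 1 \<and> q = 1 \<and> (2, 0) \<in> Q)"
      show "x + y/2 - (x' + y'/2) < 10/3"
      proof (cases "a = 2/3 \<and> b = 2/3 \<and> p = 1 \<and> q = 1")
        case False
        then have "Z \<noteq> 4/3 - b/2 + e"
          using st(2) h(4) by (auto simp: Z_def divide_eq_eq mult.commute)
        then show ?thesis using R L Z by linarith
      next
        case True
        then have "Z = 1" "e = 0" by (auto simp: Z_def e_def)
        \<comment> \<open>Beyond the strip the slack \<open>\<epsilon>\<close> excludes the value 2;
          inside it the lines from the highest and the lowest point allow it at
          \<open>(2, 0)\<close> only.\<close>
        moreover have "x + y/2 \<noteq> 2"
        proof
          assume xy: "x + y/2 = 2"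
          have "y \<le> 1"
          proof (rule ccontr)
            assume "\<not> y \<le> 1"
            then show False
              using half_upper(1)[OF k Q(1)] xy mult_pos_pos[OF eps, of "y - 1"] by force
          qed
          moreover have "-1 \<le> y"
          proof (rule ccontr)
            assume "\<not> -1 \<le> y"
            then show False
              using half_lower[OF k Q(1)] xy mult_pos_pos[OF eps, of "-1 - y"] by force
          qed
          ultimately have "y = 0" "x = 2"
            using from_top(1)[OF Q(1)] from_bottom(1)[OF Q(1)] xy True by auto
          then show False using Q(1) n True by simp
        qed
        ultimately show ?thesis using R L True by auto
      qed
    qed
  next
    case False
    then have p1: "p < 1" by simp
    define e where "e = (1 - p) * b / (2 + a)"
    have e: "e * (2 + a) = (1 - p) * b" using a_pos by (simp add: e_def)
    have "(q - 1) * (2 + a) \<le> e * (2 + a)" using chord_bottom e by (simp add: mult.commute)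
    then have "q \<le> 1 + e" using a_pos by (simp add: mult_le_cancel_right)
    note sh = shallow_bound[OF b_pos ba tall p1 h(1,2) e this]
    have Z: "Z < 4/3 - b/2 - e"
      using sh(1) h(4) by (simp add: Z_def pos_divide_less_eq mult.commute)
    consider "1 \<le> y'" | "y' \<le> -1" | "-1 \<le> y'" "y' \<le> 1" "1 \<le> q" | "-1 \<le> y'" "y' \<le> 1" "q \<le> 1"
      by linarith
    then have "x + y/2 - (x' + y'/2) < 10/3"
    proof cases
      case 1
      then have "0 \<le> x' + y'/2" by (rule half_upper(2)[OF k Q(2)])
      then show ?thesis using R Z sh(2) b_pos by linarith
    next
      case 2
      then have "-(x' + y'/2) \<le> 1 + b/2 + e" unfolding e_def by (rule half_left_lower[OF k p1 Q(2)])
      then show ?thesis using R Z by linarith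
    next
      case 3
      then have "-1/2 \<le> x'" using mid_left_nonpos[OF Q(2)] by simp
      then show ?thesis using R Z sh(2) b_pos 3 by linarith
    next
      case 4
      have "-1/2 - x' \<le> 2 * (a * (1 - p) + b * (1 - q)) / (a + b)\<^sup>2"
        using mid_left[OF Q(2)] p1 4 by simp
      \<comment> \<open>Up to the factor \<open>2 / (a + b)\<close> the first part of
        \<open>Z\<close> is the weighted harmonic mean of \<open>p\<close> and \<open>q\<close>, at
        most the arithmetic one; the part subtracted is at least \<open>1/4\<close>. The total is at
        most \<open>2 + 3/2 - 1/4 = 13/4\<close>.\<close>
      moreover have "Z \<le> 2 * (a * p + b * q) / (a + b)\<^sup>2 - 1/4"
      proof -
        have "0 \<le> a * b * (p - q)\<^sup>2" using a_pos b_pos by simp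
        then have "p * q * (a + b)\<^sup>2 \<le> (a * p + b * q) * (a * q + b * p)"
          by (simp add: power2_eq_square algebra_simps)
        then have "2 * p * q / (a * q + b * p) \<le> 2 * (a * p + b * q) / (a + b)\<^sup>2"
          using h(4) a_pos b_pos by (simp add: divide_le_eq le_divide_eq field_simps)
        moreover have "1/4 \<le> a * q / (a * q + b * p)"
        proof -
          have "2/3 * (b/2) \<le> a * q" using a_ge h(2) b_pos by (intro mult_mono) auto
          moreover have "b * p \<le> b * 1" using p1 b_pos by (intro mult_left_mono) auto
          ultimately have "a * q + b * p \<le> 4 * (a * q)" by linarith
          then show ?thesis using h(4) by (simp add: pos_le_divide_eq)
        qed
        moreover have "Z = 2 * p * q / (a * q + b * p) - a * q / (a * q + b * p)"
          by (simp add: Z_def diff_divide_distrib[symmetric] algebra_simps)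
        ultimately show ?thesis by linarith
      qed
      ultimately show ?thesis using R harmonic_sum 4 by linarith
    qed
    then show ?thesis ..
  qed
qed

section \<open>The width in the direction \<open>x\<close> or \<open>x + y\<close> for
  \<open>k = 1\<close>\<close>

lemma width_slope_one:
  assumes k: "k = 1"
  shows "(\<forall>(x, y) \<in> Q. \<forall>(x', y') \<in> Q. x - x' < 10/3) \<or>
    (\<forall>(x, y) \<in> Q. \<forall>(x', y') \<in> Q. x + y - (x' + y') < 10/3)"
proof -
  have pq: "a < p" "p \<le> 1 + a" "b < q" "q \<le> 1 + b" using p_gt p_le q_gt q_le k by auto
  define V where "V = 2 * (a * p + b * q) / (a + b)\<^sup>2"
  have R: "x \<le> 1/2 + V" if "(x, y) \<in> Q" for x y
    using right_bound[OF that] k by (simp add: V_def)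
  have s: "0 < (a + b)\<^sup>2" using a_pos b_pos by simp
  \<comment> \<open>The direction \<open>x\<close> serves in the first two cases,
    \<open>x + y\<close> in the last, where \<open>b < 1/3\<close> forces
    \<open>a > 1\<close>.\<close>
  consider "p \<le> 1" | "1 < p" "1/3 \<le> b" | "1 < p" "b < 1/3" by linarith
  then show ?thesis
  proof cases
    case 1
    then have ab: "a < 1" "1/3 < b" "b < 1" using pq ba tall by linarith+
    have q: "q \<le> 9/8"
    proof (rule ccontr)
      assume "\<not> q \<le> 9/8"
      then have "1/8 * (8/3) < (q - 1) * (2 + a)" using a_ge by (intro mult_less_le_imp_less) auto
      moreover have "b * (1 - p) \<le> 1 * (1/3)" using ab pq 1 a_ge by (intro mult_mono) auto
      ultimately show False using chord_bottom by linarith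
    qed
    \<comment> \<open>The left overhang is at most \<open>1/2\<close> wherever
      \<open>harmonic_sum\<close> does not apply, so the total is at most
      \<open>1 + 27/16 + 1/2 = 51/16\<close>.\<close>
    have V: "V \<le> 27/16"
    proof -
      have "a * p \<le> a * (9/8)" "b * q \<le> b * (9/8)" using 1 q a_pos b_pos by (auto intro!: mult_left_mono)
      then have "2 * (a * p + b * q) \<le> 9/4 * (a + b)" by (simp add: algebra_simps)
      also have "\<dots> \<le> 27/16 * (a + b)\<^sup>2"
      proof -
        have "4/3 * (a + b) \<le> (a + b) * (a + b)" using tall a_pos b_pos by (intro mult_right_mono) auto
        then show ?thesis by (simp add: power2_eq_square)
      qed
      finally show ?thesis using s by (simp add: V_def pos_divide_le_eq)
    qed
    have L: "x - x' < 10/3" if xy: "(x, y) \<in> Q" and xy': "(x', y') \<in> Q" for x y x' y'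
    proof -
      consider "1 \<le> y'" | "y' \<le> -1" | "-1 \<le> y'" "y' \<le> 1" "1 \<le> q" | "-1 \<le> y'" "y' \<le> 1" "q \<le> 1"
        by linarith
      then show ?thesis
      proof cases
        case 1
        have "(y' - 1) * (1 - q) \<le> 1 * 1"
        proof (cases "q \<le> 1")
          case True
          then show ?thesis using height[OF xy'] ab pq b_pos 1 by (intro mult_mono) auto
        next
          case False
          then have "(y' - 1) * (1 - q) \<le> 0" using 1 by (intro mult_nonneg_nonpos) auto
          then show ?thesis by simp
        qed
        then have *: "(-1/2 - x') * (2 + b) \<le> 1" using upper_part(3)[OF xy' 1] by linarith
        have "-1/2 - x' \<le> 1/2"
        proof (rule ccontr)
          assume "\<not> ?thesis"
          then have "1/2 * 2 < (-1/2 - x') * (2 + b)" using b_pos by (intro mult_strict_mono) auto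
          then show False using * by simp
        qed
        then show ?thesis using R[OF xy] V by linarith
      next
        case 2
        have "(-1 - y') * (1 - p) \<le> 1 * 1"
          using height[OF xy'] ab pq a_pos 2 \<open>p \<le> 1\<close> by (intro mult_mono) auto
        then have *: "(-1/2 - x') * (2 + a) \<le> 1" using lower_part(3)[OF xy' 2] by linarith
        have "-1/2 - x' \<le> 1/2"
        proof (rule ccontr)
          assume "\<not> ?thesis"
          then have "1/2 * 2 < (-1/2 - x') * (2 + a)" using a_pos by (intro mult_strict_mono) auto
          then show False using * by simp
        qed
        then show ?thesis using R[OF xy] V by linarith
      next
        case 3
        then have "-1/2 \<le> x'" using mid_left_nonpos[OF xy'] by simp
        then show ?thesis using R[OF xy] V by linarith
      next
        case 4
        have "-1/2 - x' \<le> 2 * (a * (1 - p) + b * (1 - q)) / (a + b)\<^sup>2"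
          using mid_left[OF xy'] \<open>p \<le> 1\<close> 4 by simp
        then show ?thesis using R[OF xy] harmonic_sum by (simp add: V_def)
      qed
    qed
    then show ?thesis by blast
  next
    case 2
    \<comment> \<open>\<open>w\<close> is the distance of the lowest point to the right of
      \<open>x = -1/2\<close>. The bounds \<open>17/10\<close> and \<open>2/5\<close> on the
      overhangs below give a total of at most \<open>31/10\<close>.\<close>
    define w where "w = 1 - q"
    have "0 < (p - 1) * (2 + b)" using 2 b_pos by simp
    then have w0: "0 < w" using chord_top a_pos by (smt (verit) w_def mult_nonneg_nonpos)
    have w1: "w < 1 - b" "w \<le> 2/3" using pq 2 by (auto simp: w_def)
    have "(a - 1) * (2 + b) \<le> (p - 1) * (2 + b)" "a * w \<le> a * (1 - b)"
      using pq w1 a_pos b_pos by auto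
    then have "a * (1 + 2 * b) \<le> 2 + b" using chord_top by (simp add: w_def algebra_simps)
    then have a1: "a * (1 + 2 * b) \<le> 1 * (2 + b)" by simp
    have a35: "a \<le> 3/5 * (2 + b)"
    proof -
      have "a * (5/3) \<le> a * (1 + 2 * b)" using 2 a_pos by (intro mult_left_mono) auto
      then show ?thesis using a1 by simp
    qed
    have ap: "a * (p - 1) \<le> 3/5 * a * w"
    proof -
      have "(p - 1) * a \<le> (p - 1) * (3/5 * (2 + b))" using a35 2 by (intro mult_left_mono) auto
      then show ?thesis using chord_top by (simp add: w_def algebra_simps)
    qed
    have V: "V \<le> 17/10"
    proof -
      define S where "S = a + b"
      have S: "4/3 \<le> S" using tall by (simp add: S_def)
      have "a * p + b * q = S + a * (p - 1) - b * w" by (simp add: w_def S_def algebra_simps)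
      also have "\<dots> \<le> S + w * (3/5 * a - b)" using ap by (simp add: algebra_simps)
      \<comment> \<open>An expression linear in \<open>w\<close> is bounded by its values at the
        ends of \<open>[0, 2/3]\<close>. With \<open>1/3 \<le> b\<close> a bound in \<open>S\<close>
        alone remains, which is sharp for \<open>17/10\<close> at \<open>S = 4/3\<close>; hence the
        factors \<open>S - 4/3\<close> below.\<close>
      also have "w * (3/5 * a - b) \<le> max 0 (2/3 * (3/5 * a - b))"
      proof (cases "0 \<le> 3/5 * a - b")
        case True
        then have "w * (3/5 * a - b) \<le> 2/3 * (3/5 * a - b)" using w1 by (intro mult_right_mono) auto
        then show ?thesis by (rule max.coboundedI2)
      next
        case False
        then have "w * (3/5 * a - b) \<le> 0" using w0 by (intro mult_nonneg_nonpos) auto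
        then show ?thesis by (rule max.coboundedI1)
      qed
      also have "S + max 0 (2/3 * (3/5 * a - b)) \<le> S + max 0 (2/5 * S - 16/45)"
        using 2 by (intro add_left_mono max.mono) (auto simp: S_def field_simps)
      finally have *: "a * p + b * q \<le> S + max 0 (2/5 * S - 16/45)" by simp
      have "(S - 4/3) * (17/10 * S) \<ge> 0" using S by (intro mult_nonneg_nonneg) auto
      then have "17/10 * S\<^sup>2 \<ge> 34/15 * S" by (simp add: power2_eq_square algebra_simps)
      moreover have "0 \<le> (S - 4/3) * (17/10 * S - 8/15)" using S by (intro mult_nonneg_nonneg) auto
      then have "17/10 * S\<^sup>2 \<ge> 14/5 * S - 32/45" by (simp add: power2_eq_square field_simps)
      ultimately have "2 * (S + max 0 (2/5 * S - 16/45)) \<le> 17/10 * S\<^sup>2"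
        using S by (auto simp: max_def)
      moreover have "2 * (a * p + b * q) \<le> 2 * (S + max 0 (2/5 * S - 16/45))" using * by simp
      ultimately have "2 * (a * p + b * q) \<le> 17/10 * S\<^sup>2" by (rule order_trans[rotated])
      then show ?thesis using s by (simp add: V_def S_def pos_divide_le_eq)
    qed
    have L: "-1/2 - x' \<le> 2/5" if xy': "(x', y') \<in> Q" for x' y'
    proof (cases "1 \<le> y'")
      case True
      have "(y' - 1) * w \<le> a * w"
        using height[OF xy'] w0 by (intro mult_right_mono) auto
      also have "\<dots> \<le> 3/5 * (2 + b) * w" using a35 w0 by (intro mult_right_mono) auto
      also have "\<dots> = (3/5 * w) * (2 + b)" by simp
      finally have "(-1/2 - x') * (2 + b) \<le> (3/5 * w) * (2 + b)"
        using upper_part(3)[OF xy' True] unfolding w_def by (rule order_trans[rotated])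
      then have "-1/2 - x' \<le> 3/5 * w" using b_pos by (simp add: mult_le_cancel_right)
      then show ?thesis using w1 by linarith
    next
      case False
      then have "(1 - y') * (1 - p) \<le> 0" using 2 by (intro mult_nonneg_nonpos) auto
      then have "(-1/2 - x') * a \<le> 0" using from_top[OF xy'] False by linarith
      then show ?thesis using a_pos by (simp add: mult_le_0_iff)
    qed
    have "x - x' < 10/3" if "(x, y) \<in> Q" "(x', y') \<in> Q" for x y x' y'
      using R[OF that(1)] L[OF that(2)] V by linarith
    then show ?thesis by blast
  next
    case 3
    have "0 \<le> (p - 1) * (2 + b)" using 3 b_pos by simp
    have "a * (1 - q) \<le> a" using pq a_pos b_pos by simp
    have a1: "1 < a" using tall 3 by simp
    \<comment> \<open>The right corner is where the line from the highest point through
      \<open>(1/2, 1)\<close> meets \<open>y = -1\<close>, the left one in \<open>L\<close> where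
      the line through \<open>(-1/2, 1)\<close> meets \<open>y = -1 - b\<close>. In the sum of both
      bounds \<open>p\<close> survives only in \<open>- b * (p - 1)\<close>.\<close>
    have R: "(x + y) * a \<le> a * (3/2) + 2 * (p - a)" if xy: "(x, y) \<in> Q" for x y
    proof -
      consider "1 \<le> y" | "y \<le> -1" | "-1 \<le> y" "y \<le> 1" by linarith
      then show ?thesis
      proof cases
        case 1
        then have "0 \<le> \<epsilon> * (y - 1)" using eps by simp
        then have "x + y \<le> 3/2" using upper_part(1)[OF xy 1] k by simp
        then have "(x + y) * a \<le> 3/2 * a" using a_pos by (intro mult_right_mono) auto
        then show ?thesis using pq by simp
      next
        case 2
        then have "0 \<le> \<epsilon> * (-1 - y)" using eps by simp
        then have "x + y \<le> 3/2" using lower_part(1)[OF xy 2] k 2 by simp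
        then have "(x + y) * a \<le> 3/2 * a" using a_pos by (intro mult_right_mono) auto
        then show ?thesis using pq by simp
      next
        case 3
        have "0 \<le> (1 + y) * (p - a)" using 3 pq by (intro mult_nonneg_nonneg) auto
        then show ?thesis using from_top(1)[OF xy 3(2)] by (simp add: algebra_simps)
      qed
    qed
    have L: "-(x + y) * a \<le> a * (3/2 + b) - (2 + b) * (p - 1)" if xy: "(x, y) \<in> Q" for x y
    proof (cases "1 \<le> y")
      case True
      then have "-(x + y) \<le> 0" using upper_part(2)[OF xy] k by simp
      then have "-(x + y) * a \<le> 0" using a_pos by (intro mult_nonpos_nonneg) auto
      moreover have "(2 + b) * (p - 1) \<le> a" using chord_top \<open>a * (1 - q) \<le> a\<close> by (simp add: mult.commute)
      moreover have "a * 1 \<le> a * (3/2 + b)" using a_pos b_pos by (intro mult_left_mono) auto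
      ultimately show ?thesis by linarith
    next
      case False
      have "0 \<le> (a - (p - 1)) * (y + 1 + b)"
        using pq height[OF xy] by (intro mult_nonneg_nonneg) auto
      then show ?thesis using from_top(2)[OF xy] False by (simp add: algebra_simps)
    qed
    have "x + y - (x' + y') < 10/3" if xy: "(x, y) \<in> Q" "(x', y') \<in> Q" for x y x' y'
    proof (rule ccontr)
      assume "\<not> ?thesis"
      then have "10/3 * a \<le> (x + y - (x' + y')) * a" using a_pos by (intro mult_right_mono) auto
      moreover have "(x + y - (x' + y')) * a = (x + y) * a + -(x' + y') * a" by (simp add: algebra_simps)
      ultimately have "10/3 * a \<le> a * (3/2) + 2 * (p - a) + (a * (3/2 + b) - (2 + b) * (p - 1))"
        using R[OF xy(1)] L[OF xy(2)] by linarith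
      also have "\<dots> = a + a * b + 2 - b * (p - 1)" by (simp add: algebra_simps)
      also have "\<dots> \<le> a + a * b + 2" using 3 b_pos by simp
      finally have "a * (7/3 - b) \<le> 2" by (simp add: algebra_simps)
      moreover have "1 * 2 < a * (7/3 - b)" using a1 3 by (intro mult_strict_mono) auto
      ultimately show False by simp
    qed
    then show ?thesis by blast
  qed
qed

end

section \<open>Unimodular maps and lattice width\<close>

lemma aff_map_simp [simp]:
  "aff_map a b c d e f (x, y) = (of_int a * x + of_int b * y + of_int e, of_int c * x + of_int d * y + of_int f)"
  by (simp add: aff_map_def)

lemma unimodular_map_inverse:
  assumes "unimodular_map T"
  obtains S where "unimodular_map S" "\<And>z. S (T z) = z" "\<And>z. T (S z) = z"
proof -
  obtain a b c d e f where det: "a * d - b * c = 1 \<or> a * d - b * c = -1" and T: "T = aff_map a b c d e f"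
    using assms unfolding unimodular_map_def by blast
  define \<delta> where "\<delta> = a * d - b * c"
  have \<delta>: "\<delta> * \<delta> = 1" using det unfolding \<delta>_def by (metis mult_1 mult_minus1 add.inverse_inverse)
  have \<delta>r: "real_of_int \<delta> * real_of_int \<delta> = 1" using \<delta> by (metis of_int_1 of_int_mult)
  \<comment> \<open>The inverse matrix is the adjugate times \<open>\<delta>\<close>, since
    \<open>\<delta>\<close> is its own inverse.\<close>
  define S where "S = aff_map (\<delta> * d) (- \<delta> * b) (- \<delta> * c) (\<delta> * a) (\<delta> * (b * f - d * e)) (\<delta> * (c * e - a * f))"
  have "(\<delta> * d) * (\<delta> * a) - (- \<delta> * b) * (- \<delta> * c) = \<delta> * \<delta> * \<delta>"
    unfolding \<delta>_def by (simp add: algebra_simps)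
  then have uS: "unimodular_map S"
    using det \<delta> unfolding unimodular_map_def S_def \<delta>_def[symmetric] by (metis mult_1)
  have \<delta>1: "real_of_int \<delta> * (of_int a * of_int d - of_int b * of_int c) = 1"
    using \<delta>r unfolding \<delta>_def by simp
  have ST: "S (T z) = z" for z
  proof (cases z)
    case (Pair x y)
    have "of_int \<delta> * (of_int a * of_int d - of_int b * of_int c) * x = x"
      "of_int \<delta> * (of_int a * of_int d - of_int b * of_int c) * y = y"
      using \<delta>1 by simp_all
    then show ?thesis unfolding Pair S_def T by (simp add: algebra_simps)
  qed
  have TS: "T (S z) = z" for z
  proof (cases z)
    case (Pair x y)
    have "of_int \<delta> * (of_int a * of_int d - of_int b * of_int c) * x = x"
      "of_int \<delta> * (of_int a * of_int d - of_int b * of_int c) * y = y"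
      "of_int \<delta> * (of_int a * of_int d - of_int b * of_int c) * real_of_int e = of_int e"
      "of_int \<delta> * (of_int a * of_int d - of_int b * of_int c) * real_of_int f = of_int f"
      using \<delta>1 by simp_all
    then show ?thesis unfolding Pair S_def T by (simp add: algebra_simps)
  qed
  show thesis using that uS ST TS by blast
qed

lemma unimodular_map_comp:
  assumes "unimodular_map S" "unimodular_map T"
  shows "unimodular_map (S \<circ> T)"
proof -
  obtain a b c d e f where S: "a * d - b * c = 1 \<or> a * d - b * c = -1" "S = aff_map a b c d e f"
    using assms(1) unfolding unimodular_map_def by blast
  obtain a' b' c' d' e' f' where T: "a' * d' - b' * c' = 1 \<or> a' * d' - b' * c' = -1" "T = aff_map a' b' c' d' e' f'"
    using assms(2) unfolding unimodular_map_def by blast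
  have "S \<circ> T = aff_map (a * a' + b * c') (a * b' + b * d') (c * a' + d * c') (c * b' + d * d')
      (a * e' + b * f' + e) (c * e' + d * f' + f)"
    unfolding S(2) T(2) by (auto simp: fun_eq_iff algebra_simps)
  moreover have "(a * a' + b * c') * (c * b' + d * d') - (a * b' + b * d') * (c * a' + d * c')
      = (a * d - b * c) * (a' * d' - b' * c')"
    by (simp add: algebra_simps)
  moreover have "(a * d - b * c) * (a' * d' - b' * c') = 1 \<or> (a * d - b * c) * (a' * d' - b' * c') = -1"
    using S(1) T(1) by auto
  ultimately show ?thesis unfolding unimodular_map_def by metis
qed

lemma unimodular_map_affine:
  assumes "unimodular_map T"
  shows "continuous_on A T" "T ((1 - u) *\<^sub>R z + u *\<^sub>R w) = (1 - u) *\<^sub>R T z + u *\<^sub>R T w"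
proof -
  obtain a b c d e f where T: "T = aff_map a b c d e f"
    using assms unfolding unimodular_map_def by blast
  show "continuous_on A T"
    unfolding T aff_map_def case_prod_beta by (intro continuous_intros)
  show "T ((1 - u) *\<^sub>R z + u *\<^sub>R w) = (1 - u) *\<^sub>R T z + u *\<^sub>R T w"
    unfolding T by (cases z; cases w) (simp add: algebra_simps)
qed

lemma unimodular_map_convex:
  assumes "unimodular_map T" "convex X"
  shows "convex (T ` X)"
proof (rule convexI)
  fix x y and u v :: real
  assume "x \<in> T ` X" "y \<in> T ` X" and uv: "0 \<le> u" "0 \<le> v" "u + v = 1"
  then obtain z w where zw: "z \<in> X" "w \<in> X" "x = T z" "y = T w" by blast
  have "u *\<^sub>R x + v *\<^sub>R y = T (u *\<^sub>R z + v *\<^sub>R w)"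
    using unimodular_map_affine(2)[OF assms(1), of v z w] uv zw by (simp add: eq_diff_eq[symmetric])
  then show "u *\<^sub>R x + v *\<^sub>R y \<in> T ` X"
    using assms(2) zw uv by (auto intro: convexD)
qed

lemma unimodular_map_interior:
  assumes "unimodular_map T"
  shows "interior (T ` X) = T ` interior X"
proof -
  have sub: "T ` interior X \<subseteq> interior (T ` X)" if T: "unimodular_map T" for T X
  proof -
    obtain S where S: "unimodular_map S" "\<And>z. S (T z) = z" "\<And>z. T (S z) = z"
      using unimodular_map_inverse[OF T] by blast
    have "T ` interior X = S -` interior X" using S(2,3) by (auto simp: image_iff) metis
    moreover have "open (S -` interior X)"
      by (intro open_vimage open_interior unimodular_map_affine(1)[OF S(1)])
    ultimately show ?thesis
      by (metis image_mono interior_maximal interior_subset)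
  qed
  obtain S where S: "unimodular_map S" "\<And>z. S (T z) = z" "\<And>z. T (S z) = z"
    using unimodular_map_inverse[OF assms] by blast
  have "S ` interior (T ` X) \<subseteq> interior (S ` T ` X)" by (rule sub[OF S(1)])
  also have "S ` T ` X = X" using S(2) by (simp add: image_image)
  finally have "T ` S ` interior (T ` X) \<subseteq> T ` interior X" by (rule image_mono)
  also have "T ` S ` interior (T ` X) = interior (T ` X)" using S(3) by (simp add: image_image)
  finally show ?thesis using sub[OF assms] by blast
qed

lemma unimod_equiv_image:
  assumes "unimodular_map T" "unimod_equiv X (T ` Y)"
  shows "unimod_equiv X Y"
proof -
  obtain S where S: "unimodular_map S" "\<And>z. S (T z) = z" "\<And>z. T (S z) = z"
    using unimodular_map_inverse[OF assms(1)] by blast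
  obtain R where R: "unimodular_map R" "R ` X = T ` Y" using assms(2) unfolding unimod_equiv_def by blast
  have "(S \<circ> R) ` X = S ` T ` Y" by (simp only: image_comp[symmetric] R(2))
  also have "\<dots> = Y" using S(2) by (simp add: image_image)
  finally have "(S \<circ> R) ` X = Y" .
  then show ?thesis using unimodular_map_comp[OF S(1) R(1)] unfolding unimod_equiv_def by blast
qed

section \<open>Lattice width and strictly narrow bodies\<close>

definition narrow :: "(real \<times> real) set \<Rightarrow> bool" where
  "narrow P \<longleftrightarrow> (\<exists>u v :: int. (u, v) \<noteq> (0, 0) \<and>
     (\<forall>x y x' y'. (x, y) \<in> P \<longrightarrow> (x', y') \<in> P \<longrightarrow> of_int u * (x - x') + of_int v * (y - y') < 10/3))"

text \<open>Cramer's rule recovers \<open>u\<close> and \<open>v\<close> from the covector pulled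
  back along the matrix.\<close>

lemma covector_nonzero:
  fixes a b c d u v :: int
  assumes det: "a * d - b * c = 1 \<or> a * d - b * c = -1" and uv: "(u, v) \<noteq> (0, 0)"
  shows "(u * a + v * c, u * b + v * d) \<noteq> (0, 0)"
proof -
  have "u * (a * d - b * c) = (u * a + v * c) * d - (u * b + v * d) * c"
    "v * (a * d - b * c) = (u * b + v * d) * a - (u * a + v * c) * b"
    by (simp_all add: algebra_simps)
  moreover have "a * d - b * c \<noteq> 0" using det by linarith
  ultimately show ?thesis
    using uv by (metis mult_eq_0_iff mult_zero_left diff_self prod.inject)
qed

lemma narrow_image:
  assumes "unimodular_map T" "narrow (T ` P)"
  shows "narrow P"
proof -
  obtain a b c d e f where det: "a * d - b * c = 1 \<or> a * d - b * c = -1" and T: "T = aff_map a b c d e f"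
    using assms unfolding unimodular_map_def by blast
  obtain u v :: int where uv: "(u, v) \<noteq> (0, 0)"
    and w: "\<And>x y x' y'. (x, y) \<in> T ` P \<Longrightarrow> (x', y') \<in> T ` P \<Longrightarrow> of_int u * (x - x') + of_int v * (y - y') < 10/3"
    using assms(2) unfolding narrow_def by blast
  have "(u * a + v * c, u * b + v * d) \<noteq> (0, 0)" by (rule covector_nonzero[OF det uv])
  moreover have "of_int (u * a + v * c) * (x - x') + of_int (u * b + v * d) * (y - y') < 10/3"
    if "(x, y) \<in> P" "(x', y') \<in> P" for x y x' y'
    using w[OF imageI[OF that(1), of T, unfolded T aff_map_simp, folded T]
        imageI[OF that(2), of T, unfolded T aff_map_simp, folded T]]
    by (simp add: algebra_simps)
  ultimately show ?thesis unfolding narrow_def by blast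
qed

lemma lattice_width_attained:
  assumes "compact P" "P \<noteq> {}" "u \<noteq> (0, 0)"
  obtains x y x' y' where "(x, y) \<in> P" "(x', y') \<in> P"
    "lattice_width P \<le> of_int (fst u) * (x - x') + of_int (snd u) * (y - y')"
proof -
  define W where "W = (\<lambda>u :: int \<times> int. \<lambda>xy :: (real \<times> real) \<times> (real \<times> real).
    \<bar>of_int (fst u) * (fst (fst xy) - fst (snd xy)) + of_int (snd u) * (snd (fst xy) - snd (snd xy))\<bar>)"
  have PP: "compact (P \<times> P)" "P \<times> P \<noteq> {}" using assms by (auto intro: compact_Times)
  have cont: "continuous_on (P \<times> P) (W u)" for u
    unfolding W_def by (intro continuous_intros)
  have bdd: "bdd_above (W u ` (P \<times> P))" for u
    using compact_imp_bounded[OF compact_continuous_image[OF cont PP(1)]] by (rule bounded_imp_bdd_above)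
  have "0 \<le> (SUP xy \<in> P \<times> P. W u xy)" for u
    using PP(2) by (metis (no_types, lifting) W_def abs_ge_zero all_not_in_conv bdd cSUP_upper2)
  then have "bdd_below ((\<lambda>u. SUP xy \<in> P \<times> P. W u xy) ` {u. u \<noteq> (0, 0)})"
    by (intro bdd_belowI2[of _ 0])
  then have le: "lattice_width P \<le> (SUP xy \<in> P \<times> P. W u xy)"
    unfolding lattice_width_def W_def using assms(3) by (intro cINF_lower) auto
  obtain z where z: "z \<in> P \<times> P" "\<And>z'. z' \<in> P \<times> P \<Longrightarrow> W u z' \<le> W u z"
    using continuous_attains_sup[OF PP cont] by blast
  then have "(SUP xy \<in> P \<times> P. W u xy) \<le> W u z" using PP(2) by (intro cSUP_least) auto
  then have lez: "lattice_width P \<le> W u z" using le by linarith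
  obtain x y x' y' where xy: "z = ((x, y), (x', y'))" by (metis surj_pair)
  show thesis
  proof (cases "0 \<le> of_int (fst u) * (x - x') + of_int (snd u) * (y - y')")
    case True
    then show ?thesis using that[of x y x' y'] z(1) lez by (simp add: xy W_def)
  next
    case False
    then show ?thesis using that[of x' y' x y] z(1) lez by (simp add: xy W_def algebra_simps)
  qed
qed

text \<open>\<open>narrow\<close> gives no uniform margin; strictness survives because compactness
  makes the supremum over pairs a maximum.\<close>

lemma narrow_imp_lattice_width_less:
  assumes "compact P" "P \<noteq> {}" "narrow P"
  shows "lattice_width P < 10/3"
proof -
  obtain u v :: int where uv: "(u, v) \<noteq> (0, 0)"
    and w: "\<And>x y x' y'. (x, y) \<in> P \<Longrightarrow> (x', y') \<in> P \<Longrightarrow> of_int u * (x - x') + of_int v * (y - y') < 10/3"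
    using assms(3) unfolding narrow_def by blast
  obtain x y x' y' where "(x, y) \<in> P" "(x', y') \<in> P"
    "lattice_width P \<le> of_int u * (x - x') + of_int v * (y - y')"
    using lattice_width_attained[OF assms(1,2) uv] by (metis fst_conv snd_conv)
  then show ?thesis using w by (meson le_less_trans)
qed

lemma lattice_width_greatest:
  assumes "compact P"
    and "\<And>u v :: int. (u, v) \<noteq> (0, 0) \<Longrightarrow>
      \<exists>(x, y) \<in> P. \<exists>(x', y') \<in> P. c \<le> \<bar>of_int u * (x - x') + of_int v * (y - y')\<bar>"
  shows "c \<le> lattice_width P"
  unfolding lattice_width_def
proof (rule cINF_greatest)
  have "(1, 0) \<in> {u :: int \<times> int. u \<noteq> (0, 0)}" by simp
  then show "{u :: int \<times> int. u \<noteq> (0, 0)} \<noteq> {}" by blast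
next
  fix u :: "int \<times> int"
  assume "u \<in> {u. u \<noteq> (0, 0)}"
  then have "(fst u, snd u) \<noteq> (0, 0)" by simp
  from assms(2)[OF this] obtain x y x' y' where xy: "(x, y) \<in> P" "(x', y') \<in> P"
    and c: "c \<le> \<bar>of_int (fst u) * (x - x') + of_int (snd u) * (y - y')\<bar>"
    by blast
  let ?W = "\<lambda>xy :: (real \<times> real) \<times> (real \<times> real).
    \<bar>of_int (fst u) * (fst (fst xy) - fst (snd xy)) + of_int (snd u) * (snd (fst xy) - snd (snd xy))\<bar>"
  have "continuous_on (P \<times> P) ?W" by (intro continuous_intros)
  then have "bdd_above (?W ` (P \<times> P))"
    by (intro bounded_imp_bdd_above compact_imp_bounded compact_continuous_image compact_Times assms(1))
  then show "c \<le> (SUP xy \<in> P \<times> P. ?W xy)"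
    using xy c by (intro cSUP_upper2[where x = "((x, y), (x', y'))"]) auto
qed

section \<open>Sections and the special triangle\<close>

lemma convex_section:
  fixes P :: "(real \<times> real) set"
  assumes "convex P" "(x1, y1) \<in> P" "(x2, y2) \<in> P" "y1 \<le> c" "c \<le> y2" "y1 < y2"
  shows "((x1 * (y2 - c) + x2 * (c - y1)) / (y2 - y1), c) \<in> P"
proof -
  have "((y2 - c) / (y2 - y1)) *\<^sub>R (x1, y1) + ((c - y1) / (y2 - y1)) *\<^sub>R (x2, y2) \<in> P"
    using assms by (intro convexD) (auto simp: add_divide_distrib[symmetric])
  moreover have "(y2 - c) * y1 + (c - y1) * y2 = c * (y2 - y1)"
    by (simp add: algebra_simps)
  then have "(y2 - c) / (y2 - y1) * y1 + (c - y1) / (y2 - y1) * y2 = c"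
    using assms(6) by (simp add: add_divide_distrib[symmetric])
  ultimately show ?thesis by (simp add: add_divide_distrib mult.commute)
qed

lemma open_segment_interior:
  fixes P :: "(real \<times> real) set"
  assumes "convex P" "z \<in> interior P" "w \<in> P" "0 \<le> u" "u < 1"
  shows "(1 - u) *\<^sub>R z + u *\<^sub>R w \<in> interior P"
proof (cases "u = 0 \<or> z = w")
  case True
  then show ?thesis using assms(2) by (auto simp: algebra_simps)
next
  case False
  then have "(1 - u) *\<^sub>R z + u *\<^sub>R w \<in> open_segment z w"
    unfolding in_segment using assms by (intro conjI exI[of _ u]) auto
  then show ?thesis
    using in_interior_closure_convex_segment[OF assms(1,2)] closure_subset assms(3) by blast
qed

text \<open>The segment from the origin to \<open>(t, s)\<close> meets the level \<open>c\<close> in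
  an interior point with non-integral abscissa. If the section went past a neighbouring integer,
  that lattice point would lie between an interior point and a point of \<open>P\<close>, hence be
  interior. The form \<open>1 < s / c\<close> covers \<open>c = 1\<close> and \<open>c = -1\<close>
  alike.\<close>

lemma lattice_section:
  fixes P :: "(real \<times> real) set"
  assumes "convex P" "(0, 0) \<in> interior P" "(t, s) \<in> P" "c \<noteq> 0" "1 < s / c"
    and free: "\<And>m :: int. (of_int m, c) \<notin> interior P"
  obtains m :: int where "\<forall>x. (x, c) \<in> P \<longrightarrow> of_int m \<le> x \<and> x \<le> of_int m + 1"
proof -
  have "1 / r < 1" "0 \<le> 1 / r" if "1 < r" for r :: real using that by auto
  from this[OF assms(5)] have s: "c / s < 1" "0 \<le> c / s" by simp_all
  have "s \<noteq> 0" using assms(5) by auto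
  define z where "z = c / s * t"
  have "(1 - c / s) *\<^sub>R (0, 0) + (c / s) *\<^sub>R (t, s) \<in> interior P"
    by (rule open_segment_interior[OF assms(1-3) s(2,1)])
  then have z: "(z, c) \<in> interior P" using \<open>s \<noteq> 0\<close> by (simp add: z_def)
  have zm: "of_int \<lfloor>z\<rfloor> < z" "z < of_int \<lfloor>z\<rfloor> + 1"
    using free[of "\<lfloor>z\<rfloor>"] z floor_correct[of z] by (auto simp: less_le)
  have between: "(y, c) \<in> interior P" if x: "(x, c) \<in> P" and y: "z < y \<and> y < x \<or> x < y \<and> y < z" for x y
  proof -
    define u where "u = (y - z) / (x - z)"
    have u: "0 \<le> u" "u < 1" using y by (auto simp: u_def field_simps)
    have "(1 - u) *\<^sub>R (z, c) + u *\<^sub>R (x, c) \<in> interior P"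
      by (rule open_segment_interior[OF assms(1) z x u])
    moreover have "(1 - u) * z + u * x = z + u * (x - z)" by (simp add: algebra_simps)
    moreover have "u * (x - z) = y - z" using y by (auto simp: u_def)
    moreover have "(1 - u) * c + u * c = c" by (simp add: algebra_simps)
    ultimately show ?thesis by simp
  qed
  have "of_int \<lfloor>z\<rfloor> \<le> x \<and> x \<le> of_int \<lfloor>z\<rfloor> + 1" if x: "(x, c) \<in> P" for x
  proof (rule ccontr)
    assume "\<not> ?thesis"
    then have "x < of_int \<lfloor>z\<rfloor> \<or> of_int (\<lfloor>z\<rfloor> + 1) < x" by auto
    then show False
    proof
      assume "x < of_int \<lfloor>z\<rfloor>"
      then show False using between[OF x, of "of_int \<lfloor>z\<rfloor>"] zm free[of "\<lfloor>z\<rfloor>"] by auto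
    next
      assume "of_int (\<lfloor>z\<rfloor> + 1) < x"
      then show False using between[OF x, of "of_int (\<lfloor>z\<rfloor> + 1)"] zm free[of "\<lfloor>z\<rfloor> + 1"] by auto
    qed
  qed
  then show thesis using that by blast
qed

section \<open>The special triangle\<close>

lemma special_triangle_halfplanes:
  "special_triangle = {(x, y). y - 2 * x \<le> 1 \<and> x + y \<le> 2 \<and> x - 2 * y \<le> 2}" (is "_ = ?H")
proof
  have H: "?H = {z. inner (-2, 1) z \<le> 1} \<inter> {z. inner (1, 1) z \<le> 2} \<inter> {z. inner (1, -2) z \<le> (2::real)}"
    by auto
  have "convex ?H" unfolding H by (intro convex_Int convex_halfspace_le)
  then show "special_triangle \<subseteq> ?H"
    unfolding special_triangle_def by (intro hull_minimal) auto
  show "?H \<subseteq> special_triangle"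
  proof
    fix z
    assume z: "z \<in> ?H"
    obtain x y where xy: "z = (x, y)" by force
    \<comment> \<open>Each barycentric coordinate is the slack in the inequality of the opposite
      edge, divided by its value 5 at the vertex.\<close>
    have eq: "(x, y) = ((2 - x + 2 * y) / 5) *\<^sub>R (1/3, 5/3) + ((2 - x - y) / 5) *\<^sub>R (-4/3, -5/3)
        + ((2 * x - y + 1) / 5) *\<^sub>R (2, 0)"
      by (simp add: field_simps)
    show "z \<in> special_triangle"
      unfolding special_triangle_def convex_hull_3 xy mem_Collect_eq
      by (rule exI conjI eq)+ (use z in \<open>auto simp: xy field_simps\<close>)
  qed
qed

lemma interior_special_triangle:
  "interior special_triangle = {(x, y). y - 2 * x < 1 \<and> x + y < 2 \<and> x - 2 * y < 2}"
proof -
  have H: "special_triangle = {z. inner (-2, 1) z \<le> 1} \<inter> {z. inner (1, 1) z \<le> 2} \<inter> {z. inner (1, -2) z \<le> (2::real)}"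
    by (auto simp: special_triangle_halfplanes)
  have "interior special_triangle = {z. inner (-2, 1) z < 1} \<inter> {z. inner (1, 1) z < 2} \<inter> {z. inner (1, -2) z < (2::real)}"
    unfolding H interior_Int by (simp add: interior_halfspace_le zero_prod_def)
  then have "z \<in> interior special_triangle \<longleftrightarrow>
      z \<in> {(x, y). y - 2 * x < 1 \<and> x + y < 2 \<and> x - 2 * y < 2}" for z
    by (cases z) simp
  then show ?thesis by blast
qed

lemma special_triangle_lattice_points:
  "interior special_triangle \<inter> lattice_points = {(0, 0), (1, 0)}"
proof
  show "interior special_triangle \<inter> lattice_points \<subseteq> {(0, 0), (1, 0)}"
  proof
    fix z
    assume z: "z \<in> interior special_triangle \<inter> lattice_points"
    then obtain a b :: int where ab: "z = (of_int a, of_int b)"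
      unfolding lattice_points_def by blast
    with z have "(of_int a, of_int b) \<in> interior special_triangle" by simp
    then have "real_of_int b - 2 * of_int a < 1" "real_of_int a + of_int b < 2"
      "real_of_int a - 2 * of_int b < 2"
      unfolding interior_special_triangle by simp_all
    then have i: "b - 2 * a < 1" "a + b < 2" "a - 2 * b < 2" by linarith+
    then have "3 * b \<le> 2" "-2 \<le> 3 * b" by linarith+
    then have "b = 0" by simp
    then have "a = 0 \<or> a = 1" using i by auto
    then show "z \<in> {(0, 0), (1, 0)}" using ab \<open>b = 0\<close> by auto
  qed
  have "(0, 0) = (real_of_int 0, real_of_int 0)" "(1, 0) = (real_of_int 1, real_of_int 0)" by auto
  then have "{(0, 0), (1, 0)} \<subseteq> lattice_points" unfolding lattice_points_def by blast
  moreover have "{(0, 0), (1, 0)} \<subseteq> interior special_triangle"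
    unfolding interior_special_triangle by auto
  ultimately show "{(0, 0), (1, 0)} \<subseteq> interior special_triangle \<inter> lattice_points" by blast
qed

text \<open>The edges are \<open>5/3\<close> times \<open>(1, 2)\<close>, \<open>(1, -1)\<close> and
  \<open>(2, 1)\<close> up to sign. The values of \<open>(u, v)\<close> on these vectors agree
  modulo 3 up to sign; if all were at most 1 in absolute value, they would agree up to sign, forcing
  \<open>u = v = 0\<close>.\<close>

lemma special_triangle_wide:
  assumes "(u, v) \<noteq> (0, 0 :: int)"
  shows "\<exists>(x, y) \<in> special_triangle. \<exists>(x', y') \<in> special_triangle.
    10/3 \<le> \<bar>of_int u * (x - x') + of_int v * (y - y')\<bar>"
proof -
  have v: "(1/3, 5/3) \<in> special_triangle" "(-4/3, -5/3) \<in> special_triangle" "(2, 0) \<in> special_triangle"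
    unfolding special_triangle_def by (auto intro: hull_inc)
  have "2 \<le> \<bar>u + 2 * v\<bar> \<or> 2 \<le> \<bar>u - v\<bar> \<or> 2 \<le> \<bar>2 * u + v\<bar>"
    using assms by (cases "u = 0"; cases "v = 0"; simp; presburger)
  then have "2 \<le> \<bar>real_of_int (u + 2 * v)\<bar> \<or> 2 \<le> \<bar>real_of_int (u - v)\<bar> \<or> 2 \<le> \<bar>real_of_int (2 * u + v)\<bar>"
    by linarith
  then consider "2 \<le> \<bar>of_int u + 2 * real_of_int v\<bar>" | "2 \<le> \<bar>of_int u - real_of_int v\<bar>"
    | "2 \<le> \<bar>2 * of_int u + real_of_int v\<bar>"
    by auto
  then show ?thesis
  proof cases
    case 1
    then have "(10/3::real) \<le> \<bar>of_int u * (1/3 - -4/3) + of_int v * (5/3 - -5/3)\<bar>" by (simp add: abs_if split: if_splits)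
    then show ?thesis using v by blast
  next
    case 2
    then have "(10/3::real) \<le> \<bar>of_int u * (2 - 1/3) + of_int v * (0 - 5/3)\<bar>" by (simp add: abs_if split: if_splits)
    then show ?thesis using v by blast
  next
    case 3
    then have "(10/3::real) \<le> \<bar>of_int u * (2 - -4/3) + of_int v * (0 - -5/3)\<bar>" by (simp add: abs_if split: if_splits)
    then show ?thesis using v by blast
  qed
qed

section \<open>Bodies with lattice points on the axis\<close>

definition axial :: "(real \<times> real) set \<Rightarrow> bool" where
  "axial P \<longleftrightarrow> compact P \<and> convex P \<and> (0, 0) \<in> interior P \<and> (1, 0) \<in> interior P \<and>
     (\<forall>m :: int. (of_int m, 1) \<notin> interior P \<and> (of_int m, -1) \<notin> interior P)"

lemma axialD:
  assumes "axial P"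
  shows "compact P" "convex P" "(0, 0) \<in> interior P" "(1, 0) \<in> interior P"
    "\<And>m :: int. (of_int m, 1) \<notin> interior P" "\<And>m :: int. (of_int m, -1) \<notin> interior P"
    "(0, 0) \<in> P" "(1, 0) \<in> P"
  using assms interior_subset unfolding axial_def by auto

lemma unimodular_aff_map:
  "a * d - b * c = 1 \<or> a * d - b * c = -1 \<Longrightarrow> unimodular_map (aff_map a b c d e f)"
  unfolding unimodular_map_def by blast

lemma axial_flip_y:
  assumes "axial P"
  shows "axial (aff_map 1 0 0 (-1) 0 0 ` P)"
proof -
  let ?T = "aff_map 1 0 0 (-1) 0 0"
  have T: "unimodular_map ?T" by (simp add: unimodular_aff_map)
  have mem: "(x, y) \<in> ?T ` X \<longleftrightarrow> (x, -y) \<in> X" for x y X by force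
  show ?thesis
    unfolding axial_def unimodular_map_interior[OF T] mem
    using axialD[OF assms] unimodular_map_convex[OF T] unimodular_map_affine(1)[OF T]
    by (auto intro: compact_continuous_image)
qed

text \<open>The map \<open>x\<close> to \<open>1 - x\<close> exchanges the two lattice points and
  turns a section in \<open>[m, m + 1]\<close> into one in \<open>[-m, -m + 1]\<close>, so
  \<open>m + n\<close> changes sign.\<close>

lemma axial_flip_x:
  assumes "axial P"
  shows "axial (aff_map (-1) 0 0 1 1 0 ` P)"
proof -
  let ?T = "aff_map (-1) 0 0 1 1 0"
  have T: "unimodular_map ?T" by (simp add: unimodular_aff_map)
  have mem: "(x, y) \<in> ?T ` X \<longleftrightarrow> (1 - x, y) \<in> X" for x y X by force
  have "(1 - of_int m, 1) \<notin> interior P" "(1 - of_int m, -1) \<notin> interior P" for m :: int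
    using axialD(5,6)[OF assms, of "1 - m"] by auto
  then show ?thesis
    unfolding axial_def unimodular_map_interior[OF T] mem
    using axialD[OF assms] unimodular_map_convex[OF T] unimodular_map_affine(1)[OF T]
    by (auto intro: compact_continuous_image)
qed

lemma section_bounds:
  assumes "axial P" "\<forall>x. (x, c) \<in> P \<longrightarrow> l \<le> x \<and> x \<le> l + 1"
    and "(x1, y1) \<in> P" "(x2, y2) \<in> P" "y1 \<le> c" "c \<le> y2" "y1 < y2"
  shows "l * (y2 - y1) \<le> x1 * (y2 - c) + x2 * (c - y1)"
    "x1 * (y2 - c) + x2 * (c - y1) \<le> (l + 1) * (y2 - y1)"
  using assms(2)[rule_format, OF convex_section[OF axialD(2)[OF assms(1)] assms(3-7)]] assms(7)
  by (auto simp: le_divide_eq divide_le_eq)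

text \<open>The direction is \<open>x + n * y\<close>. Below \<open>y = -1\<close>, segments to
  \<open>(0, 0)\<close> and \<open>(1, 0)\<close> keep it in \<open>[0, 1]\<close>; above, lines
  from the lowest point through the ends of the section let it leave by at most
  \<open>2 * \<rho> / b\<close> and \<open>2 * (1 - \<rho>) / b\<close>. The total is at most
  \<open>1 + 2 / b \<le> 5/2\<close>.\<close>

lemma narrow_of_flat_top:
  assumes P: "axial P" and B: "(r, -1 - b) \<in> P" and b: "4/3 \<le> b"
    and height: "\<forall>x y. (x, y) \<in> P \<longrightarrow> y \<le> 1"
  shows "narrow P"
proof -
  obtain n :: int where n: "\<forall>x. (x, -1) \<in> P \<longrightarrow> of_int n \<le> x \<and> x \<le> of_int n + 1"
    using lattice_section[OF axialD(2,3)[OF P] B _ _ axialD(6)[OF P]] b by auto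
  note sec = section_bounds[OF P n]
  have below: "0 \<le> x + of_int n * y" "x + of_int n * y \<le> 1" if "(x, y) \<in> P" "y \<le> -1" for x y
    using sec(1)[OF that(1) axialD(7)[OF P]] sec(2)[OF that(1) axialD(8)[OF P]] that(2)
    by (auto simp: algebra_simps)
  define \<rho> where "\<rho> = r + of_int n * (-1 - b)"
  have \<rho>: "0 \<le> \<rho>" "\<rho> \<le> 1" using below[OF B] b by (auto simp: \<rho>_def)
  have bounds: "(x + of_int n * y - 1) * b \<le> 2 * (1 - \<rho>)" "- (x + of_int n * y) * b \<le> 2 * \<rho>"
    if xy: "(x, y) \<in> P" for x y
  proof -
    have "(x + of_int n * y - 1) * b \<le> 2 * (1 - \<rho>) \<and> - (x + of_int n * y) * b \<le> 2 * \<rho>"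
    proof (cases "y \<le> -1")
      case True
      then have "(x + of_int n * y - 1) * b \<le> 0" "- (x + of_int n * y) * b \<le> 0"
        using below[OF xy] b by (auto intro!: mult_nonpos_nonneg)
      moreover have "0 \<le> 2 * (1 - \<rho>)" "0 \<le> 2 * \<rho>" using \<rho> by auto
      ultimately show ?thesis by (meson order_trans)
    next
      case False
      have "of_int n * (y + 1 + b) \<le> r * (y + 1) + x * b" "r * (y + 1) + x * b \<le> (of_int n + 1) * (y + 1 + b)"
        using sec[OF B xy] False b by (auto simp: algebra_simps)
      moreover have "\<rho> * (y + 1) + (x + of_int n * y) * b = r * (y + 1) + x * b - of_int n * (y + 1 + b)"
        by (simp add: \<rho>_def algebra_simps)
      ultimately have "0 \<le> \<rho> * (y + 1) + (x + of_int n * y) * b"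
        "\<rho> * (y + 1) + (x + of_int n * y) * b \<le> y + 1 + b"
        by (auto simp: algebra_simps)
      moreover have "\<rho> * (y + 1) \<le> \<rho> * 2" "(1 - \<rho>) * (y + 1) \<le> (1 - \<rho>) * 2"
        using mult_left_mono[of "y + 1" 2 \<rho>] mult_left_mono[of "y + 1" 2 "1 - \<rho>"] \<rho> height[rule_format, OF xy] by auto
      ultimately show ?thesis by (simp add: algebra_simps)
    qed
    then show "(x + of_int n * y - 1) * b \<le> 2 * (1 - \<rho>)" "- (x + of_int n * y) * b \<le> 2 * \<rho>" by auto
  qed
  have "of_int 1 * (x - x') + of_int n * (y - y') < 10/3" if "(x, y) \<in> P" "(x', y') \<in> P" for x y x' y'
  proof (rule ccontr)
    assume "\<not> ?thesis"
    then have "7/3 * b \<le> (x + of_int n * y - 1 + - (x' + of_int n * y')) * b"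
      using b by (intro mult_right_mono) (auto simp: algebra_simps)
    also have "\<dots> \<le> 2" using bounds(1)[OF that(1)] bounds(2)[OF that(2)] by (simp add: distrib_right)
    finally show False using b by simp
  qed
  then show ?thesis unfolding narrow_def by (intro exI[of _ 1] exI[of _ n]) auto
qed

lemma narrow_or_special:
  assumes P: "axial P" and T: "(t, 1 + a) \<in> P" and B: "(r, -1 - b) \<in> P"
    and height: "\<forall>x y. (x, y) \<in> P \<longrightarrow> -1 - b \<le> y \<and> y \<le> 1 + a"
    and ab: "0 < b" "b \<le> a" "4/3 \<le> a + b"
    and m: "\<forall>x. (x, 1) \<in> P \<longrightarrow> of_int m \<le> x \<and> x \<le> of_int m + 1"
    and n: "\<forall>x. (x, -1) \<in> P \<longrightarrow> of_int n \<le> x \<and> x \<le> of_int n + 1"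
    and mn: "m + n \<le> (0 :: int)"
  shows "narrow P \<or> unimod_equiv special_triangle P"
proof -
  \<comment> \<open>\<open>s\<close> and \<open>d\<close> solve the two linear equations that move
    the midpoints of \<open>[m, m + 1]\<close> at \<open>y = 1\<close> and \<open>[n, n + 1]\<close>
    at \<open>y = -1\<close> to \<open>x = 0\<close>.\<close>
  define s where "s = (of_int n - of_int m) / (2 :: real)"
  define d where "d = - (of_int m + of_int n + 1) / (2 :: real)"
  define k where "k = - (of_int m + of_int n) / (2 :: real)"
  have s1: "- (s + d) = of_int m + 1/2" "s - d = of_int n + 1/2" "d = k - 1/2"
    by (simp_all add: s_def d_def k_def field_simps)
  have centre: "\<bar>X\<bar> \<le> D / 2" if "l * D \<le> X + (l + 1/2) * D" "X + (l + 1/2) * D \<le> (l + 1) * D"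
    for l D X :: real
    using that unfolding abs_le_iff by (simp add: distrib_right)
  define f where "f = (\<lambda>(x, y). (x + s * y + d, y :: real))"
  define Q where "Q = f ` P"
  have Q: "(x, y) \<in> Q \<longleftrightarrow> (x - s * y - d, y) \<in> P" for x y
    unfolding Q_def f_def by (auto simp: image_iff case_prod_beta intro!: bexI[of _ "(x - s * y - d, y)"])
  obtain \<epsilon> where \<epsilon>: "0 < \<epsilon>" "(1 + \<epsilon>, 0) \<in> P"
  proof -
    obtain e where e: "0 < e" "ball (1, 0) e \<subseteq> P" using axialD(4)[OF P] by (auto simp: mem_interior)
    then have "(1 + e/2, 0) \<in> ball (1, 0) e" by (simp add: dist_Pair_Pair dist_real_def)
    then show thesis using that[of "e/2"] e by auto
  qed
  interpret centred_sections Q k a b "1/2 - (t + s * (1 + a) + d)" "1/2 - (r + s * (-1 - b) + d)" \<epsilon>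
  proof
    fix x1 y1 x2 y2
    assume 1: "(x1, y1) \<in> Q" "(x2, y2) \<in> Q" and y: "y1 < y2"
    note P12 = 1[unfolded Q]
    {
      assume c: "y1 \<le> 1" "1 \<le> y2"
      have eq: "(x1 - s * y1 - d) * (y2 - 1) + (x2 - s * y2 - d) * (1 - y1)
          = x1 * (y2 - 1) + x2 * (1 - y1) + - (s + d) * (y2 - y1)"
        by (simp add: algebra_simps)
      show "\<bar>x1 * (y2 - 1) + x2 * (1 - y1)\<bar> \<le> (y2 - y1) / 2"
        using section_bounds[OF P m P12 c y, unfolded eq s1(1)]
        by (intro centre[of "of_int m"]) simp_all
    next
      assume c: "y1 \<le> -1" "-1 \<le> y2"
      have eq: "(x1 - s * y1 - d) * (y2 - -1) + (x2 - s * y2 - d) * (-1 - y1)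
          = x1 * (y2 + 1) + x2 * (-1 - y1) + (s - d) * (y2 - y1)"
        by (simp add: algebra_simps)
      show "\<bar>x1 * (y2 + 1) + x2 * (-1 - y1)\<bar> \<le> (y2 - y1) / 2"
        using section_bounds[OF P n P12 c y, unfolded eq s1(2)]
        by (intro centre[of "of_int n"]) simp_all
    }
  qed (use T B height ab \<epsilon> axialD(7)[OF P] in \<open>auto simp: Q s1(3)\<close>)
  have PQ: "(x + s * y + d, y) \<in> Q" if "(x, y) \<in> P" for x y using that by (simp add: Q)
  \<comment> \<open>The direction \<open>x + c * y\<close> of the centred body is
    \<open>x + (s + c) * y\<close> in \<open>P\<close>, so \<open>s + c\<close> must be an integer;
    for half-integral \<open>s\<close> this permits \<open>c = 1/2\<close>.\<close>
  have narrowI: "narrow P"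
    if w: "\<And>x y x' y'. (x, y) \<in> Q \<Longrightarrow> (x', y') \<in> Q \<Longrightarrow> x + c * y - (x' + c * y') < 10/3"
      and v: "of_int v = s + c" for c v
  proof -
    have "of_int 1 * (x - x') + of_int v * (y - y') < 10/3" if "(x, y) \<in> P" "(x', y') \<in> P" for x y x' y'
      using w[OF that[THEN PQ]] unfolding v by (simp add: algebra_simps)
    then show ?thesis unfolding narrow_def by (intro exI[of _ 1] exI[of _ v]) auto
  qed
  have "- 3 < real_of_int (m + n)" using slope_bound by (simp add: k_def)
  then consider "m + n = 0" | "m + n = -1" | "m + n = -2" using mn by linarith
  then show ?thesis
  proof cases
    case 1
    then have n': "n = - m" by simp
    then have "k = 0" by (simp add: k_def)
    then have "narrow P"
      using width_slope_zero by (intro narrowI[of 0 "-m"]) (auto simp: s_def n')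
    then show ?thesis ..
  next
    case 3
    then have n': "n = - m - 2" by simp
    then have "k = 1" by (simp add: k_def)
    have s: "s = - of_int m - 1" by (simp add: s_def n' field_simps)
    from width_slope_one[OF \<open>k = 1\<close>] have "narrow P"
    proof
      assume "\<forall>(x, y) \<in> Q. \<forall>(x', y') \<in> Q. x - x' < 10/3"
      then show "narrow P" by (intro narrowI[of 0 "-m - 1"]) (auto simp: s)
    next
      assume "\<forall>(x, y) \<in> Q. \<forall>(x', y') \<in> Q. x + y - (x' + y') < 10/3"
      then show "narrow P" by (intro narrowI[of 1 "-m"]) (auto simp: s)
    qed
    then show ?thesis ..
  next
    case 2
    then have n': "n = - m - 1" by simp
    then have k: "k = 1/2" by (simp add: k_def)
    have d0: "d = 0" and s: "s = - of_int m - 1/2" by (simp_all add: d_def s_def n' field_simps)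
    show ?thesis
    proof (cases "\<forall>x y x' y'. (x, y) \<in> Q \<longrightarrow> (x', y') \<in> Q \<longrightarrow> x + y/2 - (x' + y'/2) < 10/3")
      case True
      then have "narrow P" by (intro narrowI[of "1/2" "-m"]) (auto simp: s)
      then show ?thesis ..
    next
      case False
      then obtain x y x' y' where "(x, y) \<in> Q" "(x', y') \<in> Q" "\<not> x + y/2 - (x' + y'/2) < 10/3"
        by blast
      with width_slope_half[OF k] have ab: "a = 2/3" "b = 2/3"
        and p: "1/2 - (t + s * (1 + a) + d) = 1" and q: "1/2 - (r + s * (-1 - b) + d) = 1"
        and R: "(2, 0) \<in> Q"
        by blast+
      \<comment> \<open>Undoing the shear takes \<open>w\<close> to
        \<open>w - s * y = (w + y/2) + m * y\<close>: the half shear produces the special triangle,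
        the integral rest is \<open>S\<close>.\<close>
      define S where "S = aff_map 1 m 0 1 0 0"
      have S: "unimodular_map S" by (simp add: S_def unimodular_aff_map)
      have vertices: "S (1/3, 5/3) \<in> P" "S (-4/3, -5/3) \<in> P" "S (2, 0) \<in> P"
      proof -
        have "t = 1/3 + of_int m * (5/3)" "r = -4/3 + of_int m * (-5/3)"
          using p q unfolding ab d0 s by (simp_all add: field_simps)
        then show "S (1/3, 5/3) \<in> P" "S (-4/3, -5/3) \<in> P" using T B by (simp_all add: S_def ab)
        show "S (2, 0) \<in> P" using R by (simp add: S_def Q d0)
      qed
      have "S ` special_triangle = P"
      proof
        obtain S' where S': "unimodular_map S'" "\<And>z. S' (S z) = z" "\<And>z. S (S' z) = z"
          using unimodular_map_inverse[OF S] by blast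
        have "{(1/3, 5/3), (-4/3, -5/3), (2, 0)} \<subseteq> S' ` P"
          using vertices S'(2) by (metis empty_subsetI image_eqI insert_subset)
        then have "special_triangle \<subseteq> S' ` P"
          unfolding special_triangle_def
          by (intro hull_minimal unimodular_map_convex[OF S'(1) axialD(2)[OF P]])
        then have "S ` special_triangle \<subseteq> S ` S' ` P" by (rule image_mono)
        then show "S ` special_triangle \<subseteq> P" using S'(3) by (simp add: image_image)
        show "P \<subseteq> S ` special_triangle"
        proof
          fix z
          assume z: "z \<in> P"
          obtain x y where xy: "z = (x, y)" by force
          define w where "w = x + s * y"
          have w: "(w, y) \<in> Q" using PQ[of x y] z by (simp add: xy w_def d0)
          \<comment> \<open>In centred coordinates the sides are \<open>w = -1/2\<close> and the two
            lines from \<open>(2, 0)\<close> to the highest and the lowest point. Points beyond the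
            level \<open>1\<close> or \<open>-1\<close> are bounded through their segment to
            \<open>(2, 0)\<close>.\<close>
          have "y - 2 * (w + y/2) \<le> 1 \<and> w + y/2 + y \<le> 2 \<and> w + y/2 - 2 * y \<le> 2"
          proof -
            have r1: "2 * w + 3 * y \<le> 4"
            proof (cases "y \<le> 1")
              case True
              then show ?thesis using from_top(1)[OF w, unfolded p, unfolded ab] by simp
            next
              case False
              then have "\<bar>2 * (y - 1) + w * (1 - 0)\<bar> \<le> (y - 0) / 2" by (intro upper[OF R w]) auto
              from abs_le_D1[OF this] show ?thesis by (simp add: field_simps)
            qed
            have r2: "2 * w - 3 * y \<le> 4"
            proof (cases "-1 \<le> y")
              case True
              then show ?thesis using from_bottom(1)[OF w, unfolded q, unfolded ab] by simp
            next
              case False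
              then have "\<bar>w * (0 + 1) + 2 * (-1 - y)\<bar> \<le> (0 - y) / 2" by (intro lower[OF w R]) auto
              from abs_le_D1[OF this] show ?thesis by (simp add: field_simps)
            qed
            have r3: "-1/2 \<le> w"
              using from_top(2)[OF w, unfolded p, unfolded ab] from_bottom(2)[OF w, unfolded q, unfolded ab]
              by (cases "y \<le> 1") auto
            show ?thesis using r1 r2 r3 by simp
          qed
          then have "(w + y/2, y) \<in> special_triangle" unfolding special_triangle_halfplanes by simp
          moreover have "S (w + y/2, y) = z" by (simp add: S_def xy w_def s algebra_simps)
          ultimately show "z \<in> S ` special_triangle" by (metis image_eqI)
        qed
      qed
      then have "unimod_equiv special_triangle P" using S unfolding unimod_equiv_def by blast
      then show ?thesis ..
    qed
  qed
qed

lemma axial_dichotomy_sections: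
  assumes P: "axial P" and T: "(t, 1 + a) \<in> P" and B: "(r, -1 - b) \<in> P"
    and height: "\<forall>x y. (x, y) \<in> P \<longrightarrow> -1 - b \<le> y \<and> y \<le> 1 + a"
    and ab: "0 < b" "b \<le> a" "4/3 \<le> a + b"
  shows "narrow P \<or> unimod_equiv special_triangle P"
proof -
  obtain m :: int where m: "\<forall>x. (x, 1) \<in> P \<longrightarrow> of_int m \<le> x \<and> x \<le> of_int m + 1"
    using lattice_section[OF axialD(2,3)[OF P] T _ _ axialD(5)[OF P]] ab by auto
  obtain n :: int where n: "\<forall>x. (x, -1) \<in> P \<longrightarrow> of_int n \<le> x \<and> x \<le> of_int n + 1"
    using lattice_section[OF axialD(2,3)[OF P] B _ _ axialD(6)[OF P]] ab by auto
  show ?thesis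
  proof (cases "m + n \<le> 0")
    case True
    then show ?thesis using narrow_or_special[OF P T B height ab m n] by blast
  next
    case False
    define F where "F = aff_map (-1) 0 0 1 1 0"
    have F: "unimodular_map F" by (simp add: F_def unimodular_aff_map)
    have mem: "(x, y) \<in> F ` P \<longleftrightarrow> (1 - x, y) \<in> P" for x y unfolding F_def by force
    have "narrow (F ` P) \<or> unimod_equiv special_triangle (F ` P)"
    proof (rule narrow_or_special[of _ "1 - t" a "1 - r" b "-m" "-n"])
      show "axial (F ` P)" unfolding F_def by (rule axial_flip_x[OF P])
      show "\<forall>x. (x, 1) \<in> F ` P \<longrightarrow> of_int (-m) \<le> x \<and> x \<le> of_int (-m) + 1"
        using m unfolding mem by force
      show "\<forall>x. (x, -1) \<in> F ` P \<longrightarrow> of_int (-n) \<le> x \<and> x \<le> of_int (-n) + 1"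
        using n unfolding mem by force
    qed (use T B height ab False in \<open>auto simp: mem\<close>)
    then show ?thesis using narrow_image[OF F] unimod_equiv_image[OF F] by blast
  qed
qed

lemma axial_dichotomy:
  assumes P: "axial P"
  shows "narrow P \<or> unimod_equiv special_triangle P"
proof -
  note cP = axialD(1)[OF P]
  have ne: "P \<noteq> {}" using axialD(7)[OF P] by blast
  have cont: "continuous_on P snd" by (intro continuous_intros)
  obtain t h where T: "(t, h) \<in> P" "\<And>x y. (x, y) \<in> P \<Longrightarrow> y \<le> h"
    using continuous_attains_sup[OF cP ne cont] by force
  obtain r l where B: "(r, l) \<in> P" "\<And>x y. (x, y) \<in> P \<Longrightarrow> l \<le> y"
    using continuous_attains_inf[OF cP ne cont] by force
  define a b where "a = h - 1" and "b = -1 - l"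
  have T': "(t, 1 + a) \<in> P" and B': "(r, -1 - b) \<in> P" using T B by (auto simp: a_def b_def)
  have height: "\<forall>x y. (x, y) \<in> P \<longrightarrow> -1 - b \<le> y \<and> y \<le> 1 + a"
    using T(2) B(2) by (auto simp: a_def b_def)
  define F where "F = aff_map 1 0 0 (-1) 0 0"
  have F: "unimodular_map F" by (simp add: F_def unimodular_aff_map)
  have mem: "(x, y) \<in> F ` P \<longleftrightarrow> (x, -y) \<in> P" for x y unfolding F_def by force
  have FP: "axial (F ` P)" unfolding F_def by (rule axial_flip_y[OF P])
  have TF: "(t, -1 - a) \<in> F ` P" and BF: "(r, 1 + b) \<in> F ` P" using T' B' by (auto simp: mem add.commute)
  have heightF: "\<forall>x y. (x, y) \<in> F ` P \<longrightarrow> -1 - a \<le> y \<and> y \<le> 1 + b"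
    using height unfolding mem by fastforce
  \<comment> \<open>In the first case the height \<open>2 + a + b\<close> is already small enough;
    the third and fifth case are reduced to the second and fourth by reflection in the axis.\<close>
  consider "a + b < 4/3" | "4/3 \<le> a + b" "a \<le> 0" | "4/3 \<le> a + b" "b \<le> 0"
    | "4/3 \<le> a + b" "0 < b" "b \<le> a" | "4/3 \<le> a + b" "0 < a" "a \<le> b"
    by linarith
  then show ?thesis
  proof cases
    case 1
    then have "of_int 0 * (x - x') + of_int 1 * (y - y') < 10/3" if "(x, y) \<in> P" "(x', y') \<in> P" for x y x' y'
      using height[rule_format, OF that(1)] height[rule_format, OF that(2)] 1 by simp
    then show ?thesis unfolding narrow_def by (intro disjI1 exI[of _ 0] exI[of _ 1]) auto
  next
    case 2
    then show ?thesis using narrow_of_flat_top[OF P B'] height by force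
  next
    case 3
    then have "narrow (F ` P)" using narrow_of_flat_top[OF FP TF] heightF by force
    then show ?thesis using narrow_image[OF F] by blast
  next
    case 4
    then show ?thesis using axial_dichotomy_sections[OF P T' B' height] by blast
  next
    case 5
    then have "narrow (F ` P) \<or> unimod_equiv special_triangle (F ` P)"
      using axial_dichotomy_sections[OF FP BF TF heightF] by (simp add: add.commute)
    then show ?thesis using narrow_image[OF F] unimod_equiv_image[OF F] by blast
  qed
qed

section \<open>Reduction of the theorem to axial bodies\<close>

lemma delta2_free_axial_image:
  assumes "is_polygon P" "delta2_free P"
    and "p \<in> interior P \<inter> lattice_points" "q \<in> interior P \<inter> lattice_points" "p \<noteq> q"
  obtains T where "unimodular_map T" "axial (T ` P)"
proof -
  have P: "compact P" "convex P" "rel_interior P = interior P"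
    using assms(1) unfolding is_polygon_def
    by (auto simp: finite_imp_compact_convex_hull rel_interior_nonempty_interior)
  obtain p1 p2 q1 q2 :: int where pq: "p = (of_int p1, of_int p2)" "q = (of_int q1, of_int q2)"
    using assms(3,4) unfolding lattice_points_def by blast
  define g where "g = gcd (q1 - p1) (q2 - p2)"
  have "q1 - p1 \<noteq> 0 \<or> q2 - p2 \<noteq> 0" using assms(5) by (auto simp: pq)
  then have g: "0 < g" by (auto simp: g_def)
  obtain a b where ab: "q1 - p1 = g * a" "q2 - p2 = g * b"
    by (metis dvd_def g_def gcd_dvd1 gcd_dvd2)
  obtain x y where "x * (q1 - p1) + y * (q2 - p2) = g" unfolding g_def using bezout_int by blast
  then have "g * (x * a + y * b) = g * 1" unfolding ab by (simp add: algebra_simps)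
  then have "x * a + y * b = 1" using g by (metis mult_cancel_left less_irrefl)
  then have det: "a * x - (-y) * b = 1" by (simp add: algebra_simps)
  \<comment> \<open>The Bezout coefficients complete the primitive vector \<open>(a, b)\<close> to a
    matrix of determinant 1; \<open>S\<close> sends \<open>(0, 0)\<close> to \<open>p\<close> and
    \<open>(1, 0)\<close> to the next lattice point towards \<open>q\<close>.\<close>
  define S where "S = aff_map a (-y) b x p1 p2"
  have S: "unimodular_map S" using det by (simp add: S_def unimodular_aff_map)
  obtain T where T: "unimodular_map T" "\<And>z. T (S z) = z" "\<And>z. S (T z) = z"
    using unimodular_map_inverse[OF S] by blast
  have mem: "z \<in> interior (T ` P) \<longleftrightarrow> S z \<in> interior P" for z
    unfolding unimodular_map_interior[OF T(1)] using T(2,3) by (metis image_iff)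
  have S0: "S (0, 0) \<in> interior P" using assms(3) by (simp add: S_def pq)
  have "(1 - 1 / of_int g) *\<^sub>R p + (1 / of_int g) *\<^sub>R q \<in> interior P"
    using assms(3,4) g convex_interior[OF P(2)] by (intro convexD) auto
  moreover have "(1 - 1 / of_int g) *\<^sub>R p + (1 / of_int g) *\<^sub>R q = S (1, 0)"
  proof -
    have "real_of_int q1 = of_int p1 + of_int g * of_int a" "real_of_int q2 = of_int p2 + of_int g * of_int b"
      using ab by (metis add_diff_cancel_left' diff_add_cancel add.commute of_int_add of_int_mult)+
    then show ?thesis using g by (simp add: S_def pq field_simps)
  qed
  ultimately have S1: "S (1, 0) \<in> interior P" by simp
  have free: "S (of_int m, of_int \<sigma>) \<notin> interior P" if \<sigma>: "\<sigma> = 1 \<or> \<sigma> = -1" for m \<sigma> :: int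
  proof
    assume Sm: "S (of_int m, of_int \<sigma>) \<in> interior P"
    \<comment> \<open>\<open>V\<close> agrees with \<open>S\<close> on \<open>(0, 0)\<close> and
      \<open>(1, 0)\<close> and sends \<open>(0, 1)\<close> to \<open>S (m, \<sigma>)\<close>, so it
      maps the standard simplex to a forbidden copy.\<close>
    define V where "V = S \<circ> aff_map 1 m 0 \<sigma> 0 0"
    have V: "unimodular_map V"
      unfolding V_def using \<sigma> by (intro unimodular_map_comp[OF S]) (simp add: unimodular_aff_map)
    obtain W where W: "unimodular_map W" "\<And>z. W (V z) = z" "\<And>z. V (W z) = z"
      using unimodular_map_inverse[OF V] by blast
    have "V z \<in> interior P" if "z \<in> {(0, 0), (1, 0), (0, 1)}" for z
      using that S0 S1 Sm by (auto simp: V_def)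
    then have "{(0, 0), (1, 0), (0, 1)} \<subseteq> W ` interior P" using W(2) by (metis image_eqI subsetI)
    then have "std_simplex \<subseteq> W ` interior P"
      unfolding std_simplex_def
      by (intro hull_minimal unimodular_map_convex[OF W(1)] convex_interior P)
    then have "V ` std_simplex \<subseteq> V ` W ` interior P" by (rule image_mono)
    also have "\<dots> = interior P" using W(3) by (simp add: image_image)
    finally show False using assms(2) V unfolding delta2_free_def P(3) by blast
  qed
  have "axial (T ` P)"
    unfolding axial_def mem using S0 S1 free[of 1] free[of "-1"]
    by (simp add: P unimodular_map_convex[OF T(1)] compact_continuous_image unimodular_map_affine(1)[OF T(1)])
  then show thesis using that T(1) by blast
qed

lemma lattice_width_special:
  assumes "unimod_equiv special_triangle P"
  shows "lattice_width P = 10/3"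
proof -
  obtain R where R: "unimodular_map R" "R ` special_triangle = P"
    using assms unfolding unimod_equiv_def by blast
  have "compact special_triangle"
    unfolding special_triangle_def by (intro finite_imp_compact_convex_hull) auto
  then have P: "compact P"
    unfolding R(2)[symmetric] by (intro compact_continuous_image unimodular_map_affine(1)[OF R(1)])
  have "(2, 0) \<in> special_triangle" by (simp add: special_triangle_halfplanes)
  then have ne: "P \<noteq> {}" using R(2) by blast
  have "10/3 \<le> lattice_width P"
  proof (rule lattice_width_greatest[OF P])
    fix u v :: int
    assume uv: "(u, v) \<noteq> (0, 0)"
    obtain a b c d e f where det: "a * d - b * c = 1 \<or> a * d - b * c = -1" and R': "R = aff_map a b c d e f"
      using R(1) unfolding unimodular_map_def by blast
    have nz: "(u * a + v * c, u * b + v * d) \<noteq> (0, 0)" by (rule covector_nonzero[OF det uv])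
    obtain x y x' y' where xy: "(x, y) \<in> special_triangle" "(x', y') \<in> special_triangle"
      and w: "10/3 \<le> \<bar>of_int (u * a + v * c) * (x - x') + of_int (u * b + v * d) * (y - y')\<bar>"
      using special_triangle_wide[OF nz] by blast
    have "of_int (u * a + v * c) * (x - x') + of_int (u * b + v * d) * (y - y')
        = of_int u * (fst (R (x, y)) - fst (R (x', y'))) + of_int v * (snd (R (x, y)) - snd (R (x', y')))"
      by (simp add: R' algebra_simps)
    moreover have "R (x, y) \<in> P" "R (x', y') \<in> P" using xy R(2) by blast+
    ultimately show "\<exists>(x, y) \<in> P. \<exists>(x', y') \<in> P. 10/3 \<le> \<bar>of_int u * (x - x') + of_int v * (y - y')\<bar>"
      using w by (intro bexI[of _ "R (x, y)"]) (simp_all add: case_prod_beta bexI[of _ "R (x', y')"])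
  qed
  moreover have "lattice_width P \<le> 10/3"
  proof -
    obtain S where S: "unimodular_map S" "\<And>z. S (R z) = z" "\<And>z. R (S z) = z"
      using unimodular_map_inverse[OF R(1)] by blast
    obtain a b c d e f where det: "a * d - b * c = 1 \<or> a * d - b * c = -1" and S': "S = aff_map a b c d e f"
      using S(1) unfolding unimodular_map_def by blast
    \<comment> \<open>The second row of the inverse map reads off the height in the special
      triangle, which ranges over \<open>[-5/3, 5/3]\<close>.\<close>
    have cd: "(c, d) \<noteq> (0, 0)" using det by auto
    have range: "\<bar>of_int c * x + of_int d * y + of_int f\<bar> \<le> 5/3" if "(x, y) \<in> P" for x y
    proof -
      define X Y where "X = of_int a * x + of_int b * y + of_int e" and "Y = of_int c * x + of_int d * y + of_int f"
      have "(X, Y) = S (x, y)" by (simp add: S' X_def Y_def)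
      then have "(X, Y) \<in> special_triangle" using that S(2) R(2) by force
      then have "Y - 2 * X \<le> 1" "X + Y \<le> 2" "X - 2 * Y \<le> 2"
        unfolding special_triangle_halfplanes by simp_all
      then have "\<bar>Y\<bar> \<le> 5/3" by linarith
      then show ?thesis by (simp add: Y_def)
    qed
    obtain x y x' y' where xy: "(x, y) \<in> P" "(x', y') \<in> P"
      and le: "lattice_width P \<le> of_int c * (x - x') + of_int d * (y - y')"
      using lattice_width_attained[OF P ne cd] by (metis fst_conv snd_conv)
    have "of_int c * (x - x') + of_int d * (y - y')
        = (of_int c * x + of_int d * y + of_int f) - (of_int c * x' + of_int d * y' + of_int f)"
      by (simp add: algebra_simps)
    also have "\<dots> \<le> 5/3 - (- 5/3)"
      by (rule diff_mono[OF abs_le_D1[OF range[OF xy(1)]]]) (use abs_le_D2[OF range[OF xy(2)]] in linarith)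
    finally show ?thesis using le by simp
  qed
  ultimately show ?thesis by simp
qed

theorem theorem4p5:
  fixes P :: "(real \<times> real) set"
  assumes "is_polygon P"
    and "delta2_free P"
    and "\<exists>p q. p \<in> interior P \<inter> lattice_points \<and> q \<in> interior P \<inter> lattice_points \<and> p \<noteq> q"
  shows "lattice_width P \<le> 10/3
         \<and> (lattice_width P = 10/3 \<longleftrightarrow> unimod_equiv special_triangle P)
         \<and> card (interior special_triangle \<inter> lattice_points) = 2"
proof -
  obtain T where T: "unimodular_map T" "axial (T ` P)"
    using assms delta2_free_axial_image by metis
  have "compact P" "P \<noteq> {}"
    using assms(1) unfolding is_polygon_def by (auto simp: finite_imp_compact_convex_hull)
  then have "lattice_width P < 10/3 \<or> unimod_equiv special_triangle P"
    using axial_dichotomy[OF T(2)] narrow_image[OF T(1)] unimod_equiv_image[OF T(1)]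
      narrow_imp_lattice_width_less by blast
  then show ?thesis
    using lattice_width_special[of P] by (auto simp: special_triangle_lattice_points)
qed

end
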